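(* Let $D\subset\subset\mathbb{C}^n$ be a bounded domain and let $a\in D$. Then there exists a complex analytic set $Z\subset D$ with $\dim Z<n$ such that for every $b\in D\setminus Z$ and every holomorphic automorphism $f$ of $D$ with $f(a)=a$ and $f(b)=b$, the fixed point set $\mathrm{Fix}(f)=\{x\in D : f(x)=x\}$ has complex dimension at least one.
   Context: A domain is a connected nonempty open set. A holomorphic automorphism is a biholomorphic self-map. The fixed point set of $f$ is a complex analytic subset of $D$, and its dimension is its dimension as an analytic set. *)

theory Defs
  imports "HOL-Analysis.Analysis"
begin

definition holo_fun_on :: "(complex^'n \<Rightarrow> complex) \<Rightarrow> (complex^'n) set \<Rightarrow> bool" where
  "holo_fun_on f U \<longleftrightarrow>
     (\<forall>z\<in>U. \<exists>L. (f has_derivative L) (at z) \<and> (\<forall>c v. L (c *s v) = c * L v))"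

definition holo_map_on :: "(complex^'n \<Rightarrow> complex^'m) \<Rightarrow> (complex^'n) set \<Rightarrow> bool" where
  "holo_map_on f U \<longleftrightarrow> (\<forall>i. holo_fun_on (\<lambda>z. f z $ i) U)"

text \<open>Maps are total functions in HOL; the values of \<open>f\<close> outside \<open>U\<close> are irrelevant here.\<close>

definition biholomorphic ::
  "(complex^'n \<Rightarrow> complex^'n) \<Rightarrow> (complex^'n) set \<Rightarrow> (complex^'n) set \<Rightarrow> bool" where
  "biholomorphic f U V \<longleftrightarrow>
     bij_betw f U V \<and> holo_map_on f U \<and> holo_map_on (inv_into U f) V"

definition domain_Cn :: "(complex^'n) set \<Rightarrow> bool" where
  "domain_Cn D \<longleftrightarrow> open D \<and> connected D \<and> D \<noteq> {}"

definition holo_automorphism :: "(complex^'n) set \<Rightarrow> (complex^'n \<Rightarrow> complex^'n) \<Rightarrow> bool" where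
  "holo_automorphism D f \<longleftrightarrow> biholomorphic f D D"

text \<open>The local equations are required near every point of \<open>D\<close>, not only near the points
  of \<open>Z\<close>, so that \<open>Z\<close> is closed in \<open>D\<close>.\<close>

definition analytic_subset :: "(complex^'n) set \<Rightarrow> (complex^'n) set \<Rightarrow> bool" where
  "analytic_subset D Z \<longleftrightarrow> Z \<subseteq> D \<and>
     (\<forall>p\<in>D. \<exists>U F. open U \<and> p \<in> U \<and> U \<subseteq> D \<and> finite F \<and> (\<forall>g\<in>F. holo_fun_on g U) \<and>
        Z \<inter> U = {z\<in>U. \<forall>g\<in>F. g z = 0})"

text \<open>Near \<open>p\<close>, the set \<open>A\<close> is a \<open>d\<close>-dimensional complex submanifold: in some holomorphic
  chart around \<open>p\<close> it is the coordinate subspace spanned by the \<open>d\<close> axes indexed by \<open>I\<close>.\<close>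

definition regular_point :: "(complex^'n) set \<Rightarrow> complex^'n \<Rightarrow> nat \<Rightarrow> bool" where
  "regular_point A p d \<longleftrightarrow> p \<in> A \<and>
     (\<exists>U V \<phi> I. open U \<and> p \<in> U \<and> open V \<and> biholomorphic \<phi> U V \<and> card I = d \<and>
        \<phi> ` (A \<inter> U) = {w\<in>V. \<forall>i. i \<notin> I \<longrightarrow> w $ i = 0})"

text \<open>The dimension of an analytic set is the largest dimension at its regular points;
  these dimensions are bounded by \<open>CARD('n)\<close>, so the maximum is over a finite set.
  The empty set has dimension \<open>-1\<close>.\<close>

definition analytic_dim :: "(complex^'n) set \<Rightarrow> int" where
  "analytic_dim A = Max (insert (-1) {int d | d p. regular_point A p d})"

end

(*
Linearize the isotropy group of a by a single map: there is a holomorphic phi on D with derivative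
id at a and phi o g = g'(a) o phi for every automorphism g fixing a. The classical phi is a Haar
average of g'(a)^(-1) o g. To avoid Haar measure, phi is found as a minimizer of a strictly convex
invariant functional: the group acts on maps psi by psi |-> g'(a)^(-1) o psi o g and preserves a
convex set K of uniformly bounded holomorphic maps with derivative id at a, compact by Montel.
The supremum over the group of a weighted l^2-norm along a dense sequence is invariant under this
action and has a unique minimizer on K, which is therefore a fixed point.

Take Z = {phi = 0}, nowhere dense by the identity theorem. If f fixes a and b and phi(b) is nonzero,
then phi(b) is an eigenvector of f'(a) for the eigenvalue 1. Since phi is a local chart at a which
conjugates f to f'(a), near a the set Fix(f) is the preimage of this eigenspace, a submanifold of
positive dimension.
*)
theory Submission
  imports Defs "HOL-Complex_Analysis.Great_Picard"
begin

section \<open>Holomorphic maps in several variables\<close>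

lemma norm_vector_smult: "norm (c *s (v::complex^'n)) = norm c * norm v"
  by (simp add: norm_vec_def norm_mult L2_set_right_distrib)

lemma norm_vec_le_sum: "norm (v::complex^'n) \<le> (\<Sum>i\<in>UNIV. norm (v $ i))"
  unfolding norm_vec_def by (rule L2_set_le_sum) simp

lemma scaleR_eq_smult: "r *\<^sub>R (v::complex^'n) = complex_of_real r *s v"
  by (simp add: vec_eq_iff) (simp add: scaleR_conv_of_real)

text \<open>The difference quotients converge componentwise; boundedness of \<open>L\<close> comes
  from the sum of the operator norms of its components.\<close>

lemma has_derivative_vecI:
  fixes f :: "'a::real_normed_vector \<Rightarrow> 'b::real_normed_vector^'m"
  assumes "\<And>i. ((\<lambda>x. f x $ i) has_derivative (\<lambda>x. L x $ i)) (at z)"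
  shows "(f has_derivative L) (at z)"
proof -
  have bl: "bounded_linear (\<lambda>x. L x $ i)" for i
    using assms has_derivative_bounded_linear by blast
  have "bounded_linear L"
  proof (rule bounded_linear_intro[where K = "\<Sum>i\<in>UNIV. onorm (\<lambda>x. L x $ i)"])
    show "L (x + y) = L x + L y" for x y
      using linear_add[OF bounded_linear.linear[OF bl]] by (simp add: vec_eq_iff)
    show "L (r *\<^sub>R x) = r *\<^sub>R L x" for r x
      using linear_scale[OF bounded_linear.linear[OF bl]] by (simp add: vec_eq_iff)
    show "norm (L x) \<le> norm x * (\<Sum>i\<in>UNIV. onorm (\<lambda>x. L x $ i))" for x
    proof -
      have "norm (L x) \<le> (\<Sum>i\<in>UNIV. norm (L x $ i))"
        unfolding norm_vec_def by (rule L2_set_le_sum) simp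
      also have "\<dots> \<le> (\<Sum>i\<in>UNIV. onorm (\<lambda>x. L x $ i) * norm x)"
        by (intro sum_mono onorm bl)
      finally show ?thesis by (simp add: sum_distrib_left mult.commute)
    qed
  qed
  moreover have "((\<lambda>y. (f y - f z - L (y - z)) /\<^sub>R norm (y - z)) \<longlongrightarrow> 0) (at z)"
    using assms unfolding has_derivative_at_within
    by (intro vec_tendstoI) auto
  ultimately show ?thesis
    by (simp add: has_derivative_at_within)
qed

section \<open>Holomorphic maps with vector values\<close>

text \<open>A coordinate-free form of \<open>holo_map_on\<close>: a Frechet derivative that commutes
  with complex scalars. The chain rule and closure under linear operations follow directly, without
  passing to components.\<close>

definition holo :: "(complex^'n \<Rightarrow> complex^'m) \<Rightarrow> (complex^'n) set \<Rightarrow> bool" where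
  "holo f U \<longleftrightarrow> (\<forall>z\<in>U. \<exists>L. (f has_derivative L) (at z) \<and> (\<forall>c v. L (c *s v) = c *s L v))"

lemma holo_map_on_iff_holo: "holo_map_on f U \<longleftrightarrow> holo f U"
proof
  assume f: "holo_map_on f U"
  show "holo f U"
    unfolding holo_def
  proof
    fix z assume "z \<in> U"
    then have "\<forall>i. \<exists>L. ((\<lambda>z. f z $ i) has_derivative L) (at z) \<and> (\<forall>c v. L (c *s v) = c * L v)"
      using f by (simp add: holo_map_on_def holo_fun_on_def)
    then obtain L where L: "\<And>i. ((\<lambda>z. f z $ i) has_derivative L i) (at z)"
      "\<And>i c v. L i (c *s v) = c * L i v"
      by metis
    show "\<exists>L. (f has_derivative L) (at z) \<and> (\<forall>c v. L (c *s v) = c *s L v)"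
      by (rule exI[of _ "\<lambda>v. \<chi> i. L i v"]) (auto intro!: has_derivative_vecI simp: L vec_eq_iff)
  qed
next
  assume f: "holo f U"
  show "holo_map_on f U"
    unfolding holo_map_on_def holo_fun_on_def
  proof (intro allI ballI)
    fix i z assume "z \<in> U"
    then obtain L where L: "(f has_derivative L) (at z)" "\<forall>c v. L (c *s v) = c *s L v"
      using f by (auto simp: holo_def)
    show "\<exists>L. ((\<lambda>z. f z $ i) has_derivative L) (at z) \<and> (\<forall>c v. L (c *s v) = c * L v)"
      by (rule exI[of _ "\<lambda>v. L v $ i"])
        (auto intro!: bounded_linear.has_derivative[OF bounded_linear_vec_nth] L(1) simp: L(2))
  qed
qed

lemma holo_subset: "holo f U \<Longrightarrow> V \<subseteq> U \<Longrightarrow> holo f V"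
  by (auto simp: holo_def)

lemma holo_imp_continuous_on: "holo f U \<Longrightarrow> continuous_on U f"
  by (meson continuous_at_imp_continuous_on has_derivative_continuous holo_def)

lemma holo_has_derivative_linear:
  assumes "holo f U" "z \<in> U" "(f has_derivative L) (at z)"
  shows "L (c *s v) = c *s L v"
  using assms has_derivative_unique unfolding holo_def by blast

lemma holo_compose:
  assumes f: "holo f U" and g: "holo g V" and "\<And>x. x \<in> U \<Longrightarrow> f x \<in> V"
  shows "holo (\<lambda>x. g (f x)) U"
  unfolding holo_def
proof
  fix z assume z: "z \<in> U"
  obtain L where L: "(f has_derivative L) (at z)" "\<forall>c v. L (c *s v) = c *s L v"
    using f z by (auto simp: holo_def)
  obtain M where M: "(g has_derivative M) (at (f z))" "\<forall>c v. M (c *s v) = c *s M v"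
    using g assms(3)[OF z] by (auto simp: holo_def)
  show "\<exists>L. ((\<lambda>x. g (f x)) has_derivative L) (at z) \<and> (\<forall>c v. L (c *s v) = c *s L v)"
    by (rule exI[of _ "\<lambda>v. M (L v)"]) (use L M has_derivative_compose in auto)
qed

lemma holo_linear:
  assumes "linear L" "\<And>c v. L (c *s v) = c *s L v"
  shows "holo L U"
  unfolding holo_def
  using assms bounded_linear_imp_has_derivative linear_conv_bounded_linear by blast

lemma holo_add:
  assumes f: "holo f U" and g: "holo g U"
  shows "holo (\<lambda>x. f x + g x) U"
  unfolding holo_def
proof
  fix z assume z: "z \<in> U"
  obtain L where L: "(f has_derivative L) (at z)" "\<forall>c v. L (c *s v) = c *s L v"
    using f z by (auto simp: holo_def)
  obtain M where M: "(g has_derivative M) (at z)" "\<forall>c v. M (c *s v) = c *s M v"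
    using g z by (auto simp: holo_def)
  show "\<exists>L. ((\<lambda>x. f x + g x) has_derivative L) (at z) \<and> (\<forall>c v. L (c *s v) = c *s L v)"
    by (rule exI[of _ "\<lambda>v. L v + M v"])
      (use L M in \<open>auto intro!: has_derivative_add simp: vec.scale_right_distrib\<close>)
qed

lemma holo_smult: "holo f U \<Longrightarrow> holo (\<lambda>x. c *s f x) U"
  by (rule holo_compose[where V = UNIV and g = "\<lambda>v. c *s v", OF _ holo_linear])
    (auto intro!: linearI simp: vec.scale_right_distrib vec_eq_iff)

lemma holo_const: "holo (\<lambda>x. c) U"
  unfolding holo_def by (auto intro!: exI[of _ "\<lambda>v. 0"])

lemma holo_ident: "holo (\<lambda>x. x) U"
  unfolding holo_def by (auto intro!: exI[of _ "\<lambda>v. v"])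

lemma holo_diff: "holo f U \<Longrightarrow> holo g U \<Longrightarrow> holo (\<lambda>x. f x - g x) U"
  using holo_add[of f U "\<lambda>x. (-1) *s g x"] holo_smult[of g U "-1"] by simp

section \<open>Restriction to complex lines and Cauchy estimates\<close>

lemma has_derivative_complex_line:
  fixes x v :: "complex^'n"
  shows "((\<lambda>t. x + t *s v) has_derivative (\<lambda>t. t *s v)) (at t0)"
proof -
  have "linear (\<lambda>t. t *s v)"
    by (rule linearI) (auto simp: vec.scale_left_distrib vec_eq_iff)
  then have "((\<lambda>t. t *s v) has_derivative (\<lambda>t. t *s v)) (at t0)"
    by (simp add: bounded_linear_imp_has_derivative linear_conv_bounded_linear)
  from has_derivative_add[OF has_derivative_const this] show ?thesis
    by simp
qed

text \<open>Complex homogeneity of \<open>L\<close> turns the real derivative along the line into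
  multiplication by \<open>L v $ i\<close>. This is the way in for one-variable theory: Cauchy's
  inequality and analytic continuation.\<close>

lemma holo_complex_line_field_derivative:
  fixes f :: "complex^'n \<Rightarrow> complex^'m"
  assumes f: "holo f U" and x: "x + t *s v \<in> U" and L: "(f has_derivative L) (at (x + t *s v))"
  shows "((\<lambda>t. f (x + t *s v) $ i) has_field_derivative (L v $ i)) (at t)"
proof -
  have "((\<lambda>t. f (x + t *s v)) has_derivative (\<lambda>t. L (t *s v))) (at t)"
    by (rule has_derivative_compose[OF has_derivative_complex_line L])
  then have "((\<lambda>t. f (x + t *s v) $ i) has_derivative (\<lambda>t. L (t *s v) $ i)) (at t)"
    by (rule bounded_linear.has_derivative[OF bounded_linear_vec_nth])
  moreover have "(\<lambda>t. L (t *s v) $ i) = (*) (L v $ i)"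
    by (auto simp: holo_has_derivative_linear[OF f x L])
  ultimately show ?thesis
    by (simp add: has_field_derivative_def)
qed

lemma holo_complex_line_holomorphic:
  fixes f :: "complex^'n \<Rightarrow> complex^'m"
  assumes f: "holo f U" and x: "\<And>t. t \<in> T \<Longrightarrow> x + t *s v \<in> U"
  shows "(\<lambda>t. f (x + t *s v) $ i) holomorphic_on T"
  unfolding holomorphic_on_def
proof
  fix t assume "t \<in> T"
  then obtain L where "(f has_derivative L) (at (x + t *s v))"
    using f x by (meson holo_def)
  then show "(\<lambda>t. f (x + t *s v) $ i) field_differentiable at t within T"
    using holo_complex_line_field_derivative[OF f x] \<open>t \<in> T\<close>
    by (meson field_differentiable_at_within field_differentiable_def)
qed

text \<open>Cauchy's inequality for each component on the disc \<open>x + t *s v\<close> with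
  \<open>norm t \<le> s\<close>. The radius \<open>s = r / (2 * norm v)\<close> keeps the closed
  disc inside the open ball and costs the factor 2; summing the components costs
  \<open>CARD('m)\<close>.\<close>

lemma holo_derivative_bound:
  fixes f :: "complex^'n \<Rightarrow> complex^'m" and M :: real
  assumes f: "holo f (ball x r)" and r: "0 < r" and M: "\<And>y. y \<in> ball x r \<Longrightarrow> norm (f y) \<le> M"
    and L: "(f has_derivative L) (at x)"
  shows "norm (L v) \<le> 2 * real CARD('m) * M / r * norm v"
proof (cases "v = 0")
  case True
  then show ?thesis
    using has_derivative_bounded_linear[OF L] by (simp add: bounded_linear.linear linear_0)
next
  case False
  define s where "s = r / (2 * norm v)"
  have s: "0 < s" "s * norm v < r" using False r by (auto simp: s_def)
  have mem: "x + t *s v \<in> ball x r" if "norm t \<le> s" for t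
  proof -
    have "norm (t *s v) < r"
      using s mult_right_mono[OF that norm_ge_zero[of v]] by (simp add: norm_vector_smult)
    then show ?thesis
      by (simp add: dist_norm)
  qed
  have "norm (L v $ i) \<le> 2 * M / r * norm v" for i
  proof -
    let ?u = "\<lambda>t. f (x + t *s v) $ i"
    have hol: "?u holomorphic_on cball 0 s"
      by (rule holo_complex_line_holomorphic[OF f]) (use mem in auto)
    have "norm ((deriv ^^ 1) ?u 0) \<le> fact 1 * M / s ^ 1"
    proof (rule Cauchy_inequality)
      show "?u holomorphic_on ball 0 s"
        using hol ball_subset_cball holomorphic_on_subset by blast
      show "continuous_on (cball 0 s) ?u"
        using hol holomorphic_on_imp_continuous_on by blast
      show "norm (?u t) \<le> M" if "norm (0 - t) = s" for t
        using that order_trans[OF Finite_Cartesian_Product.norm_nth_le M[OF mem[of t]]] by simp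
    qed (rule s)
    moreover have "deriv ?u 0 = L v $ i"
      by (rule DERIV_imp_deriv, rule holo_complex_line_field_derivative[OF f]) (use r L in auto)
    ultimately show ?thesis
      using False r by (simp add: s_def field_simps)
  qed
  then have "(\<Sum>i\<in>UNIV. norm (L v $ i)) \<le> real CARD('m) * (2 * M / r * norm v)"
    by (intro sum_bounded_above)
  also have "\<dots> = 2 * real CARD('m) * M / r * norm v"
    by simp
  finally show ?thesis
    by (rule order_trans[OF norm_vec_le_sum])
qed

text \<open>Every point of the half ball is the centre of a ball of radius \<open>r/2\<close> on
  which \<open>M\<close> still bounds \<open>f\<close>, so the derivative bound holds there
  uniformly. The half ball is convex, and the mean value inequality applies.\<close>

lemma holo_lipschitz:
  fixes f :: "complex^'n \<Rightarrow> complex^'m" and M :: real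
  assumes f: "holo f (ball x r)" and r: "0 < r" and M: "\<And>y. y \<in> ball x r \<Longrightarrow> norm (f y) \<le> M"
    and yz: "y \<in> ball x (r/2)" "z \<in> ball x (r/2)"
  shows "norm (f y - f z) \<le> 4 * real CARD('m) * M / r * norm (y - z)"
proof -
  have "\<forall>w\<in>ball x r. \<exists>L. (f has_derivative L) (at w)"
    using f by (auto simp: holo_def)
  then obtain L where L: "\<And>w. w \<in> ball x r \<Longrightarrow> (f has_derivative L w) (at w)"
    by metis
  have sub: "ball w (r/2) \<subseteq> ball x r" if "w \<in> ball x (r/2)" for w
  proof
    fix u assume "u \<in> ball w (r/2)"
    then show "u \<in> ball x r"
      using that dist_triangle[of x u w] by simp
  qed
  have bound: "norm (L w v) \<le> 2 * real CARD('m) * M / (r/2) * norm v" if "w \<in> ball x (r/2)" for w v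
  proof (rule holo_derivative_bound)
    show "holo f (ball w (r/2))" using f sub[OF that] holo_subset by blast
    show "(f has_derivative L w) (at w)" by (rule L) (use that r in simp)
    show "norm (f y) \<le> M" if "y \<in> ball w (r/2)" for y
      using M sub[OF \<open>w \<in> ball x (r/2)\<close>] that by blast
  qed (use r in simp)
  show ?thesis
  proof (rule differentiable_bound[where S = "ball x (r/2)" and f' = L])
    show "(f has_derivative L w) (at w within ball x (r / 2))" if "w \<in> ball x (r/2)" for w
      by (rule has_derivative_at_withinI, rule L) (use that r in simp)
    show "onorm (L w) \<le> 4 * real CARD('m) * M / r" if "w \<in> ball x (r/2)" for w
      by (rule onorm_le) (use bound[OF that] in \<open>simp add: mult.assoc\<close>)
  qed (use yz in simp_all)
qed

section \<open>Montel's theorem\<close>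

lemma compact_finite_net:
  fixes S X :: "'a::metric_space set"
  assumes "compact S" "S \<subseteq> closure X" "0 < e"
  obtains F where "finite F" "F \<subseteq> X" "S \<subseteq> (\<Union>x\<in>F. ball x e)"
proof -
  have "S \<subseteq> (\<Union>x\<in>X. ball x e)"
    using assms by (force simp: closure_approachable subset_iff)
  then show ?thesis
    using compactE_image[OF \<open>compact S\<close>, of X "\<lambda>x. ball x e"] that by (metis open_ball)
qed

text \<open>A finite net of points of \<open>X\<close> carries smallness to all of \<open>S\<close>,
  because the Lipschitz constant is common to all indices. The filter is arbitrary, so that both
  single indices and pairs of indices can be used.\<close>

lemma equilipschitz_eventually_small:
  fixes u :: "'i \<Rightarrow> 'a::metric_space \<Rightarrow> 'b::real_normed_vector"
  assumes "compact S" "S \<subseteq> closure X" "0 < e" "0 \<le> C"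
    and lip: "\<And>i x y. x \<in> S \<Longrightarrow> y \<in> X \<Longrightarrow> norm (u i x - u i y) \<le> C * dist x y"
    and lim: "\<And>x. x \<in> X \<Longrightarrow> ((\<lambda>i. u i x) \<longlongrightarrow> 0) F"
  shows "\<forall>\<^sub>F i in F. \<forall>x\<in>S. norm (u i x) < e"
proof -
  \<comment> \<open>The summand 1 keeps the denominator positive when \<open>C = 0\<close>.\<close>
  define d where "d = e / (2 * (C + 1))"
  have d: "0 < d" "C * d \<le> e / 2"
    using assms(3,4) by (auto simp: d_def field_simps)
  obtain N where N: "finite N" "N \<subseteq> X" "S \<subseteq> (\<Union>x\<in>N. ball x d)"
    using compact_finite_net[OF assms(1,2) d(1)] .
  have "\<forall>\<^sub>F i in F. \<forall>y\<in>N. norm (u i y) < e / 2"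
    using N tendstoD[OF lim, of _ "e/2"] \<open>0 < e\<close>
    by (intro eventually_ball_finite) auto
  then show ?thesis
  proof (rule eventually_mono, intro ballI)
    fix i x assume i: "\<forall>y\<in>N. norm (u i y) < e / 2" and x: "x \<in> S"
    obtain y where y: "y \<in> N" "dist x y < d"
      using N(3) x by (auto simp: dist_commute)
    have "norm (u i x) \<le> norm (u i x - u i y) + norm (u i y)"
      by (metis norm_triangle_sub add.commute)
    also have "norm (u i x - u i y) \<le> C * d"
      using lip[of x y i] x y N(2) mult_left_mono[of "dist x y" d C] \<open>0 \<le> C\<close> by force
    finally show "norm (u i x) < e"
      using i y(1) d(2) by force
  qed
qed

lemma tendsto_vector_smult:
  fixes f :: "'i \<Rightarrow> complex^'n"
  assumes "(f \<longlongrightarrow> l) F"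
  shows "((\<lambda>i. c *s f i) \<longlongrightarrow> c *s l) F"
  by (rule vec_tendstoI, unfold vector_smult_component)
    (intro tendsto_mult tendsto_const tendsto_vec_nth assms)

text \<open>Cantor's diagonal argument over an enumeration of \<open>X\<close>, with
  Bolzano-Weierstrass at each point.\<close>

lemma diagonal_convergent_subsequence:
  fixes f :: "nat \<Rightarrow> 'a \<Rightarrow> 'b::heine_borel"
  assumes "countable X" "\<And>x. x \<in> X \<Longrightarrow> bounded (range (\<lambda>k. f k x))"
  obtains s where "strict_mono (s :: nat \<Rightarrow> nat)" "\<And>x. x \<in> X \<Longrightarrow> convergent (\<lambda>k. f (s k) x)"
proof (cases "X = {}")
  case True
  then show ?thesis using that[of id] by (simp add: strict_mono_id)
next
  case False
  let ?x = "from_nat_into X"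
  have x: "?x i \<in> X" for i using False by (rule from_nat_into)
  let ?P = "\<lambda>i r. convergent (\<lambda>k. f (r k :: nat) (?x i))"
  have "\<exists>k. strict_mono (k :: nat \<Rightarrow> nat) \<and> ?P i (r \<circ> k)" for i r
  proof -
    have "bounded (range (\<lambda>k. f (r k) (?x i)))"
      by (rule bounded_subset[OF assms(2)[OF x]]) auto
    from bounded_imp_convergent_subsequence[OF this]
    show ?thesis by (auto simp: convergent_def o_def)
  qed
  \<comment> \<open>Convergence passes to any sequence that is, from some index on, drawn from the
    given one at indices at least as large; the diagonal sequence needs this at every stage.\<close>
  moreover have "?P i (r \<circ> k2)"
    if P: "?P i (r \<circ> k1)" and k: "\<And>j. N \<le> j \<Longrightarrow> \<exists>j'. j \<le> j' \<and> k2 j = k1 j'" for i r k1 k2 N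
  proof -
    obtain l where l: "(\<lambda>k. f (r (k1 k)) (?x i)) \<longlonglongrightarrow> l"
      using P by (auto simp: convergent_def)
    have "(\<lambda>k. f (r (k2 k)) (?x i)) \<longlonglongrightarrow> l"
      unfolding lim_sequentially
    proof (intro allI impI)
      fix e :: real assume "0 < e"
      then obtain N0 where "\<forall>n\<ge>N0. dist (f (r (k1 n)) (?x i)) l < e"
        using l unfolding lim_sequentially by blast
      then show "\<exists>no. \<forall>n\<ge>no. dist (f (r (k2 n)) (?x i)) l < e"
        using k by (intro exI[of _ "max N N0"]) (metis le_trans max.bounded_iff)
    qed
    then show ?thesis by (auto simp: convergent_def)
  qed
  ultimately obtain s where s: "strict_mono (s :: nat \<Rightarrow> nat)" "\<And>i. ?P i (id \<circ> s)"
    using subsequence_diagonalization_lemma[of ?P id] by blast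
  show ?thesis
  proof (rule that[OF s(1)])
    show "convergent (\<lambda>k. f (s k) x)" if "x \<in> X" for x
      using s(2) from_nat_into_surj[OF assms(1) that] by auto
  qed
qed

text \<open>Convergence on a countable dense set becomes locally uniform by the common Lipschitz
  bounds. The Cauchy estimate for differences then makes the derivatives converge locally uniformly
  as well. The last conclusion lets a derivative prescribed at a point survive in the limit.\<close>

lemma holo_montel:
  fixes f :: "nat \<Rightarrow> complex^'n \<Rightarrow> complex^'m" and M :: real
  assumes D: "open D" and f: "\<And>k. holo (f k) D" and M: "\<And>k z. z \<in> D \<Longrightarrow> norm (f k z) \<le> M"
  obtains s g where "strict_mono (s :: nat \<Rightarrow> nat)" "holo g D"
    "\<And>z. z \<in> D \<Longrightarrow> (\<lambda>k. f (s k) z) \<longlonglongrightarrow> g z"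
    "\<And>z L. z \<in> D \<Longrightarrow> (\<And>k. (f k has_derivative L) (at z)) \<Longrightarrow> (g has_derivative L) (at z)"
proof -
  obtain X :: "(complex^'n) set" where X: "countable X" "\<And>U. open U \<Longrightarrow> U \<noteq> {} \<Longrightarrow> \<exists>x\<in>X. x \<in> U"
    using countable_dense_setE by blast
  have "closure X = UNIV"
    using X(2) unfolding closure_approachable set_eq_iff
    by (metis UNIV_I centre_in_ball dist_commute empty_iff mem_ball open_ball)
  have "bounded (range (\<lambda>k. f k x))" if "x \<in> X \<inter> D" for x
    using M[of x] that by (auto simp: bounded_iff)
  then obtain s where s: "strict_mono s" "\<And>x. x \<in> X \<inter> D \<Longrightarrow> convergent (\<lambda>k. f (s k) x)"
    using diagonal_convergent_subsequence[of "X \<inter> D" f] X(1) by auto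
  let ?C = "real CARD('m)"
  have unif: "\<exists>N. \<forall>m\<ge>N. \<forall>k\<ge>N. \<forall>x\<in>cball p (r/4). norm (f (s k) x - f (s m) x) < e"
    if r: "0 < r" "ball p r \<subseteq> D" and e: "0 < e" for p r e
  proof -
    \<comment> \<open>With pairs as indices and the product filter, smallness of the differences is
      exactly the uniform Cauchy property. The differences are bounded by
      \<open>2 * M\<close>.\<close>
    have "\<forall>\<^sub>F (k, m) in sequentially \<times>\<^sub>F sequentially.
       \<forall>x\<in>cball p (r/4). norm (f (s k) x - f (s m) x) < e"
      unfolding case_prod_beta
    proof (rule equilipschitz_eventually_small[where X = "ball p (r/2) \<inter> X"
          and C = "4 * ?C * (2 * M) / r" and u = "\<lambda>i x. f (s (fst i)) x - f (s (snd i)) x"])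
      have "cball p (r/4) \<subseteq> ball p (r/2)" using r by auto
      then show "cball p (r/4) \<subseteq> closure (ball p (r/2) \<inter> X)"
        using open_Int_closure_subset[of "ball p (r/2)" X] \<open>closure X = UNIV\<close> by auto
      have "0 \<le> M" using M[of p 0] r by (metis centre_in_ball norm_ge_zero order_trans subsetD)
      then show "0 \<le> 4 * ?C * (2 * M) / r" using r by simp
      show "norm (f (s (fst i)) x - f (s (snd i)) x - (f (s (fst i)) y - f (s (snd i)) y))
          \<le> 4 * ?C * (2 * M) / r * dist x y"
        if "x \<in> cball p (r/4)" "y \<in> ball p (r/2) \<inter> X" for i x y
        unfolding dist_norm
      proof (rule holo_lipschitz[where x = p and f = "\<lambda>x. f (s (fst i)) x - f (s (snd i)) x"])
        show "holo (\<lambda>x. f (s (fst i)) x - f (s (snd i)) x) (ball p r)"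
          using f r(2) by (intro holo_diff holo_subset[OF f])
        show "norm (f (s (fst i)) w - f (s (snd i)) w) \<le> 2 * M" if "w \<in> ball p r" for w
          using norm_triangle_le_diff[of "f (s (fst i)) w" "f (s (snd i)) w" "2 * M"]
            M[of w "s (fst i)"] M[of w "s (snd i)"] r(2) that by force
      qed (use that r in auto)
      show "((\<lambda>i. f (s (fst i)) x - f (s (snd i)) x) \<longlongrightarrow> 0) (sequentially \<times>\<^sub>F sequentially)"
        if "x \<in> ball p (r/2) \<inter> X" for x
      proof -
        have "x \<in> X \<inter> D" using that r by force
        then obtain l where l: "(\<lambda>k. f (s k) x) \<longlonglongrightarrow> l"
          using s(2) by (auto simp: convergent_def)
        have "((\<lambda>i. f (s (fst i)) x - f (s (snd i)) x) \<longlongrightarrow> l - l) (sequentially \<times>\<^sub>F sequentially)"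
          by (intro tendsto_diff filterlim_compose[OF l] filterlim_fst filterlim_snd)
        then show ?thesis by simp
      qed
    qed (use e in auto)
    then show ?thesis
      by (simp add: eventually_prod_sequentially)
  qed
  have ball: "\<exists>r>0. ball p r \<subseteq> D" if "p \<in> D" for p
    using D that open_contains_ball by blast
  define g where "g z = lim (\<lambda>k. f (s k) z)" for z
  have g: "(\<lambda>k. f (s k) z) \<longlonglongrightarrow> g z" if z: "z \<in> D" for z
  proof -
    obtain r where r: "0 < r" "ball z r \<subseteq> D" using ball[OF z] by blast
    have "Cauchy (\<lambda>k. f (s k) z)"
    proof (rule metric_CauchyI)
      fix e :: real assume "0 < e"
      from unif[OF r this] r(1) show "\<exists>M. \<forall>m\<ge>M. \<forall>n\<ge>M. dist (f (s m) z) (f (s n) z) < e"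
        by (fastforce simp: dist_norm)
    qed
    then show ?thesis
      unfolding g_def by (simp add: Cauchy_convergent_iff convergent_LIMSEQ_iff)
  qed
  have "\<forall>k. \<forall>z\<in>D. \<exists>L. (f k has_derivative L) (at z) \<and> (\<forall>c v. L (c *s v) = c *s L v)"
    using f by (simp add: holo_def)
  then obtain L where L: "\<And>k z. z \<in> D \<Longrightarrow> (f k has_derivative L k z) (at z)"
    "\<And>k z c v. z \<in> D \<Longrightarrow> L k z (c *s v) = c *s L k z v"
    by metis
  have unif': "\<exists>N. \<forall>m\<ge>N. \<forall>k\<ge>N. \<forall>x\<in>ball p (r/8). \<forall>v. norm (L (s k) x v - L (s m) x v) \<le> e * norm v"
    if r: "0 < r" "ball p r \<subseteq> D" and e: "0 < e" for p r e
  proof -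
    \<comment> \<open>Chosen so that the Cauchy estimate on balls of radius \<open>r/8\<close>
      returns exactly \<open>e\<close>. Such a ball around a point of \<open>ball p (r/8)\<close>
      stays inside \<open>cball p (r/4)\<close>, where \<open>unif\<close> applies.\<close>
    define e' where "e' = e * (r/8) / (2 * ?C)"
    have "0 < e'" using e r by (simp add: e'_def)
    from unif[OF r this] obtain N where
      N: "\<forall>m\<ge>N. \<forall>k\<ge>N. \<forall>x\<in>cball p (r/4). norm (f (s k) x - f (s m) x) < e'"
      by blast
    show ?thesis
    proof (intro exI[of _ N] allI impI ballI)
      fix m k x v assume mk: "N \<le> m" "N \<le> k" and x: "x \<in> ball p (r/8)"
      have sub: "ball x (r/8) \<subseteq> cball p (r/4)"
      proof
        fix y assume "y \<in> ball x (r/8)"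
        then show "y \<in> cball p (r/4)" using x dist_triangle[of p y x] by simp
      qed
      have sub': "cball p (r/4) \<subseteq> D" using r by (intro order_trans[OF _ r(2)]) auto
      have xD: "x \<in> D" using x r(1) by (intro subsetD[OF r(2)]) simp
      have "norm (L (s k) x v - L (s m) x v) \<le> 2 * ?C * e' / (r/8) * norm v"
      proof (rule holo_derivative_bound[where f = "\<lambda>x. f (s k) x - f (s m) x" and x = x])
        show "holo (\<lambda>x. f (s k) x - f (s m) x) (ball x (r/8))"
          using sub sub' by (intro holo_diff holo_subset[OF f]) auto
        show "norm (f (s k) y - f (s m) y) \<le> e'" if "y \<in> ball x (r/8)" for y
          using N mk sub that by (meson less_imp_le subsetD)
        show "((\<lambda>x. f (s k) x - f (s m) x) has_derivative (\<lambda>v. L (s k) x v - L (s m) x v)) (at x)"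
          using L(1)[OF xD] by (intro has_derivative_diff)
      qed (use r in simp)
      also have "2 * ?C * e' / (r/8) = e" using r by (simp add: e'_def)
      finally show "norm (L (s k) x v - L (s m) x v) \<le> e * norm v" .
    qed
  qed
  define g' where "g' z v = lim (\<lambda>k. L (s k) z v)" for z v
  have g': "(\<lambda>k. L (s k) z v) \<longlonglongrightarrow> g' z v" if z: "z \<in> D" for z v
  proof -
    obtain r where r: "0 < r" "ball z r \<subseteq> D" using ball[OF z] by blast
    have "Cauchy (\<lambda>k. L (s k) z v)"
    proof (rule metric_CauchyI)
      fix e :: real assume e: "0 < e"
      define e' where "e' = e / (norm v + 1)"
      have "0 < e'" using e by (simp add: e'_def add_nonneg_pos)
      have "e' * norm v < e' * (norm v + 1)" using \<open>0 < e'\<close> by simp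
      also have "\<dots> = e" unfolding e'_def using norm_ge_zero[of v] by (simp add: add_nonneg_eq_0_iff)
      finally have "e' * norm v < e" .
      moreover obtain N where "\<forall>m\<ge>N. \<forall>k\<ge>N. norm (L (s k) z v - L (s m) z v) \<le> e' * norm v"
        using unif'[OF r \<open>0 < e'\<close>] r(1) by (metis centre_in_ball half_gt_zero_iff zero_less_divide_iff zero_less_numeral)
      ultimately show "\<exists>M. \<forall>m\<ge>M. \<forall>n\<ge>M. dist (L (s m) z v) (L (s n) z v) < e"
        unfolding dist_norm by (meson le_less_trans)
    qed
    then show ?thesis
      unfolding g'_def by (simp add: Cauchy_convergent_iff convergent_LIMSEQ_iff)
  qed
  have gder: "(g has_derivative g' p) (at p)" if p: "p \<in> D" for p
  proof -
    obtain r where r: "0 < r" "ball p r \<subseteq> D" using ball[OF p] by blast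
    have sub: "ball p (r/8) \<subseteq> D" using r by (intro order_trans[OF _ r(2)]) auto
    have "\<exists>g. \<forall>x\<in>ball p (r/8). (\<lambda>n. f (s n) x) \<longlonglongrightarrow> g x \<and> (g has_derivative g' x) (at x within ball p (r/8))"
    proof (rule has_derivative_sequence[where f' = "\<lambda>n. L (s n)" and ?x0.0 = p])
      show "(f (s n) has_derivative L (s n) x) (at x within ball p (r/8))" if "x \<in> ball p (r/8)" for n x
        by (rule has_derivative_at_withinI, rule L(1)) (use that sub in blast)
      show "(\<lambda>n. f (s n) p) \<longlonglongrightarrow> g p" using g[OF p] .
      show "\<forall>\<^sub>F n in sequentially. \<forall>x\<in>ball p (r/8). \<forall>h. norm (L (s n) x h - g' x h) \<le> e * norm h"
        if e: "0 < e" for e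
      proof -
        obtain N where N: "\<forall>m\<ge>N. \<forall>k\<ge>N. \<forall>x\<in>ball p (r/8). \<forall>v. norm (L (s k) x v - L (s m) x v) \<le> e * norm v"
          using unif'[OF r e] by blast
        show ?thesis
          unfolding eventually_sequentially
        proof (intro exI[of _ N] allI impI ballI)
          fix k x v assume k: "N \<le> k" and x: "x \<in> ball p (r/8)"
          have "(\<lambda>m. L (s k) x v - L (s m) x v) \<longlonglongrightarrow> L (s k) x v - g' x v"
            using g' x sub by (intro tendsto_diff tendsto_const) blast
          then show "norm (L (s k) x v - g' x v) \<le> e * norm v"
            by (rule Lim_norm_ubound[OF sequentially_bot])
              (use N k x in \<open>auto simp: eventually_sequentially intro!: exI[of _ N]\<close>)
        qed
      qed
    qed (use r in auto)
    then obtain G where G: "\<And>x. x \<in> ball p (r/8) \<Longrightarrow> (\<lambda>n. f (s n) x) \<longlonglongrightarrow> G x"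
      "\<And>x. x \<in> ball p (r/8) \<Longrightarrow> (G has_derivative g' x) (at x within ball p (r/8))"
      by blast
    have "(G has_derivative g' p) (at p)"
      using G(2)[of p] r(1) at_within_open[of p "ball p (r/8)"] by simp
    then show ?thesis
    proof (rule has_derivative_transform_within_open[where s = "ball p (r/8)"])
      show "G x = g x" if "x \<in> ball p (r/8)" for x
        using LIMSEQ_unique[OF G(1)[OF that] g] that sub by blast
    qed (use r in auto)
  qed
  show ?thesis
  proof (rule that[OF s(1) _ g])
    have "g' z (c *s v) = c *s g' z v" if "z \<in> D" for z c v
      using LIMSEQ_unique[OF g'[OF that, of "c *s v"]] tendsto_vector_smult[OF g'[OF that, of v], of c]
      by (simp add: L(2)[OF that])
    then show "holo g D" unfolding holo_def using gder by blast
    show "(g has_derivative K) (at z)" if z: "z \<in> D" and K: "\<And>k. (f k has_derivative K) (at z)" for z K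
    proof -
      have "L k z = K" for k
        using has_derivative_unique[OF L(1)[OF z] K] .
      then have "g' z v = K v" for v
        using LIMSEQ_unique[OF g'[OF z, of v], of "K v"] by simp
      then have "g' z = K" ..
      with gder[OF z] show ?thesis by simp
    qed
  qed
qed

section \<open>The identity theorem\<close>

text \<open>The interior \<open>A\<close> of the zero set is open, and it is also closed in
  \<open>D\<close>: near a limit point, every \<open>z\<close> lies on a complex line through a
  point \<open>q\<close> of \<open>A\<close>, and the one-variable identity theorem on that line
  gives \<open>f z = 0\<close>. Connectedness of \<open>D\<close> finishes.\<close>

lemma holo_identity:
  fixes f :: "complex^'n \<Rightarrow> complex^'m"
  assumes D: "open D" "connected D" and f: "holo f D"
    and W: "open W" "W \<subseteq> D" "W \<noteq> {}" "\<And>z. z \<in> W \<Longrightarrow> f z = 0" and z: "z \<in> D"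
  shows "f z = 0"
proof -
  define A where "A = interior {z\<in>D. f z = 0}"
  have "W \<subseteq> A" unfolding A_def using W by (intro interior_maximal) auto
  have AD: "A \<subseteq> D" using interior_subset[of "{z\<in>D. f z = 0}"] by (auto simp: A_def)
  have A0: "f z = 0" if "z \<in> A" for z
    using that interior_subset[of "{z\<in>D. f z = 0}"] by (auto simp: A_def)
  have "closure A \<inter> D \<subseteq> A"
  proof
    fix p assume p: "p \<in> closure A \<inter> D"
    then obtain r where r: "0 < r" "ball p r \<subseteq> D" using D(1) open_contains_ball by blast
    obtain q where q: "q \<in> A" "dist q p < r"
      using p r(1) by (auto simp: closure_approachable)
    have "f z = 0" if z: "z \<in> ball p r" for z
    proof -
      \<comment> \<open>\<open>T\<close> is the slice of the ball by the line, convex and hence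
        connected; \<open>T0\<close> is its open part lying in \<open>A\<close>. The parameter 0 is
        \<open>q\<close> and the parameter 1 is \<open>z\<close>.\<close>
      define T where "T = {t. q + t *s (z - q) \<in> ball p r}"
      define T0 where "T0 = {t. q + t *s (z - q) \<in> A \<inter> ball p r}"
      have cont: "continuous_on UNIV (\<lambda>t. q + t *s (z - q))"
        by (intro continuous_at_imp_continuous_on ballI has_derivative_continuous[OF has_derivative_complex_line])
      have "open T" "open T0"
        using continuous_open_preimage[OF cont open_UNIV, of "ball p r"]
          continuous_open_preimage[OF cont open_UNIV, of "A \<inter> ball p r"]
        by (auto simp: T_def T0_def vimage_def A_def)
      moreover have "convex T"
      proof (rule convexI)
        fix t1 t2 :: complex and u v :: real
        assume t: "t1 \<in> T" "t2 \<in> T" and uv: "0 \<le> u" "0 \<le> v" "u + v = 1"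
        have "u *\<^sub>R (q + t1 *s (z - q)) + v *\<^sub>R (q + t2 *s (z - q))
            = (u + v) *\<^sub>R q + (u *\<^sub>R t1 + v *\<^sub>R t2) *s (z - q)"
          by (simp add: vec_eq_iff algebra_simps)
        moreover have "u *\<^sub>R (q + t1 *s (z - q)) + v *\<^sub>R (q + t2 *s (z - q)) \<in> ball p r"
          using convexD[OF convex_ball, of "q + t1 *s (z - q)" p r "q + t2 *s (z - q)" u v] t uv
          by (simp add: T_def)
        ultimately show "u *\<^sub>R t1 + v *\<^sub>R t2 \<in> T"
          using uv(3) by (simp add: T_def)
      qed
      moreover have "0 \<in> T0" using q by (auto simp: T0_def dist_commute)
      moreover have "1 \<in> T" using z by (auto simp: T_def)
      moreover have "T0 \<subseteq> T" by (auto simp: T_def T0_def)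
      ultimately have "f (q + 1 *s (z - q)) $ i = 0" for i
      proof (intro analytic_continuation_open[where s = T0 and s' = T and z = 1
            and f = "\<lambda>t. f (q + t *s (z - q)) $ i" and g = "\<lambda>_. 0"])
        show "(\<lambda>t. f (q + t *s (z - q)) $ i) holomorphic_on T"
          by (rule holo_complex_line_holomorphic[OF f]) (use r(2) in \<open>auto simp: T_def\<close>)
        show "f (q + t *s (z - q)) $ i = 0" if "t \<in> T0" for t
          using that by (simp add: T0_def A0)
      qed (auto intro: convex_connected)
      then show ?thesis by (simp add: vec_eq_iff)
    qed
    then have "ball p r \<subseteq> A"
      unfolding A_def using r by (intro interior_maximal) auto
    then show "p \<in> A" using r by auto
  qed
  then have "closedin (top_of_set D) A"
    unfolding closedin_closed using AD closure_subset[of A]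
    by (intro exI[of _ "closure A"]) auto
  moreover have "openin (top_of_set D) A"
    using AD D(1) by (simp add: openin_open_eq A_def)
  ultimately have "A = {} \<or> A = D"
    using D(2) by (simp add: connected_clopen)
  then show ?thesis using \<open>W \<subseteq> A\<close> W(3) A0 z by auto
qed

section \<open>Linearization of the isotropy group\<close>

text \<open>Carrying the inverse \<open>h\<close> and both derivatives at \<open>a\<close> along makes inversion and composition
  explicit, although \<open>inv_into D\<close> of a composite is only determined on \<open>D\<close>.\<close>

definition isotropy :: "(complex^'n) set \<Rightarrow> complex^'n \<Rightarrow> (complex^'n \<Rightarrow> complex^'n) \<Rightarrow>
    (complex^'n \<Rightarrow> complex^'n) \<Rightarrow> (complex^'n \<Rightarrow> complex^'n) \<Rightarrow> (complex^'n \<Rightarrow> complex^'n) \<Rightarrow> bool" where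
  "isotropy D a g h L L' \<longleftrightarrow> holo g D \<and> holo h D \<and>
     (\<forall>z\<in>D. g z \<in> D \<and> h z \<in> D \<and> h (g z) = z \<and> g (h z) = z) \<and> g a = a \<and> h a = a \<and>
     (g has_derivative L) (at a) \<and> (h has_derivative L') (at a)"

lemma isotropy_id: "isotropy D a (\<lambda>x. x) (\<lambda>x. x) (\<lambda>v. v) (\<lambda>v. v)"
  by (simp add: isotropy_def holo_ident)

lemma isotropy_sym: "isotropy D a g h L L' \<Longrightarrow> isotropy D a h g L' L"
  by (auto simp: isotropy_def)

lemma isotropy_comp:
  assumes 1: "isotropy D a g1 h1 L1 M1" and 2: "isotropy D a g2 h2 L2 M2"
  shows "isotropy D a (\<lambda>x. g1 (g2 x)) (\<lambda>x. h2 (h1 x)) (\<lambda>v. L1 (L2 v)) (\<lambda>v. M2 (M1 v))"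
  unfolding isotropy_def
proof (intro conjI)
  show "holo (\<lambda>x. g1 (g2 x)) D" "holo (\<lambda>x. h2 (h1 x)) D"
    using holo_compose[of g2 D g1 D] holo_compose[of h1 D h2 D] 1 2
    by (simp_all add: isotropy_def)
  show "((\<lambda>x. g1 (g2 x)) has_derivative (\<lambda>v. L1 (L2 v))) (at a)"
    using has_derivative_compose[of g2 L2 a UNIV g1 L1] 1 2 by (simp add: isotropy_def)
  show "((\<lambda>x. h2 (h1 x)) has_derivative (\<lambda>v. M2 (M1 v))) (at a)"
    using has_derivative_compose[of h1 M1 a UNIV h2 M2] 1 2 by (simp add: isotropy_def)
qed (use 1 2 in \<open>simp_all add: isotropy_def\<close>)

text \<open>Both sides are the derivative at \<open>a\<close> of \<open>h \<circ> g\<close>, which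
  is the identity on \<open>D\<close>. The opposite composition follows through
  \<open>isotropy_sym\<close>.\<close>

lemma isotropy_inverse:
  assumes "isotropy D a g h L L'" "open D" "a \<in> D"
  shows "L' (L v) = v"
proof -
  have "((\<lambda>x. h (g x)) has_derivative (\<lambda>v. L' (L v))) (at a)"
    using has_derivative_compose[of g L a UNIV h L'] assms by (simp add: isotropy_def)
  moreover have "((\<lambda>x. h (g x)) has_derivative (\<lambda>v. v)) (at a)"
    by (rule has_derivative_transform_within_open[OF has_derivative_ident \<open>open D\<close> \<open>a \<in> D\<close>])
      (use assms in \<open>simp add: isotropy_def\<close>)
  ultimately have "(\<lambda>v. L' (L v)) = (\<lambda>v. v)"
    by (rule has_derivative_unique)
  then show ?thesis by (rule fun_cong)
qed

lemma isotropy_linear: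
  assumes "isotropy D a g h L L'" "a \<in> D"
  shows "bounded_linear L'" "linear L'" "L' (c *s v) = c *s L' v"
  using assms holo_has_derivative_linear[of h D a L'] has_derivative_bounded_linear[of h L' "at a"]
  by (auto simp: isotropy_def bounded_linear.linear)

text \<open>All the maps send \<open>D\<close> into the same bounded set, so the Cauchy estimates
  hold with one constant for the whole group. Through \<open>isotropy_sym\<close> the bounds cover
  \<open>g\<close> and \<open>L\<close> too.\<close>

lemma isotropy_bounds:
  fixes D :: "(complex^'n) set"
  assumes "open D" "bounded D" "a \<in> D" "0 < r" "ball a r \<subseteq> D"
  obtains C where "0 < C" "\<And>g h L L' v. isotropy D a g h L L' \<Longrightarrow> norm (L' v) \<le> C * norm v"
    "\<And>g h L L' x y. isotropy D a g h L L' \<Longrightarrow> x \<in> ball a (r/2) \<Longrightarrow> y \<in> ball a (r/2) \<Longrightarrow>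
       norm (h x - h y) \<le> C * norm (x - y)"
proof -
  obtain R where R: "0 < R" "\<And>x. x \<in> D \<Longrightarrow> norm x \<le> R"
    using \<open>bounded D\<close> by (auto simp: bounded_pos)
  let ?C = "4 * real CARD('n) * R / r"
  show ?thesis
  proof (rule that[of ?C])
    show "0 < ?C" using R assms by simp
    fix g h L L' assume "isotropy D a g h L L'"
    then have h: "holo h (ball a r)" "(h has_derivative L') (at a)" "\<And>x. x \<in> ball a r \<Longrightarrow> norm (h x) \<le> R"
      using R(2) assms(5) holo_subset[of h D "ball a r"] by (auto simp: isotropy_def)
    show "norm (L' v) \<le> ?C * norm v" for v
    proof -
      have "norm (L' v) \<le> 2 * real CARD('n) * R / r * norm v"
        by (rule holo_derivative_bound[OF h(1) \<open>0 < r\<close> h(3) h(2)])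
      also have "\<dots> \<le> ?C * norm v"
        using R assms by (intro mult_right_mono divide_right_mono) auto
      finally show ?thesis .
    qed
    show "norm (h x - h y) \<le> ?C * norm (x - y)" if "x \<in> ball a (r/2)" "y \<in> ball a (r/2)" for x y
      by (rule holo_lipschitz[OF h(1) \<open>0 < r\<close> h(3) that])
  qed
qed

section \<open>A weighted square norm along a sequence\<close>

text \<open>The square of a weighted l^2-seminorm of the samples of \<open>\<psi>\<close>. The
  geometric weights make it finite for bounded maps; since a divergent \<open>suminf\<close> has no
  specified value, the lemmas on \<open>wsq\<close> carry a bound \<open>M\<close> on the
  samples.\<close>

definition wsq :: "(nat \<Rightarrow> 'a) \<Rightarrow> ('a \<Rightarrow> 'b::real_inner) \<Rightarrow> real" where
  "wsq x \<psi> = (\<Sum>j. (1/2)^j * (norm (\<psi> (x j)))\<^sup>2)"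

lemma summable_wsq:
  assumes "\<And>j. norm (\<psi> (x j)) \<le> M"
  shows "summable (\<lambda>j. (1/2)^j * (norm (\<psi> (x j)))\<^sup>2 :: real)"
proof (rule summable_comparison_test')
  show "summable (\<lambda>j. (1/2)^j * M\<^sup>2 :: real)"
    by (intro summable_mult2 summable_geometric) simp
  show "norm ((1/2)^j * (norm (\<psi> (x j)))\<^sup>2 :: real) \<le> (1/2)^j * M\<^sup>2" for j
    using assms[of j] by (simp add: power_mono)
qed

lemma wsq_le:
  assumes "\<And>j. norm (\<psi> (x j)) \<le> M"
  shows "wsq x \<psi> \<le> 2 * M\<^sup>2"
proof -
  have "wsq x \<psi> \<le> (\<Sum>j. (1/2)^j * M\<^sup>2)"
    unfolding wsq_def using assms
    by (intro suminf_le summable_wsq[of \<psi> x M, OF assms] summable_mult2 summable_geometric mult_left_mono power_mono) auto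
  also have "\<dots> = 2 * M\<^sup>2"
    using suminf_mult2[OF summable_geometric[of "1/2::real"], of "M\<^sup>2"] suminf_geometric[of "1/2::real"] by simp
  finally show ?thesis .
qed

lemma wsq_nonneg:
  assumes "\<And>j. norm (\<psi> (x j)) \<le> M"
  shows "0 \<le> wsq x \<psi>"
  unfolding wsq_def by (rule suminf_nonneg[OF summable_wsq[of \<psi> x M, OF assms]]) simp

lemma term_le_wsq:
  assumes "\<And>j. norm (\<psi> (x j)) \<le> M"
  shows "(1/2)^j * (norm (\<psi> (x j)))\<^sup>2 \<le> wsq x \<psi>"
  using sum_le_suminf[OF summable_wsq[of \<psi> x M, OF assms], of "{j}"] by (simp add: wsq_def)

text \<open>The parallelogram law holds term by term. In this form it is a quantitative strict
  convexity: the defect at the midpoint measures the half difference.\<close>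

lemma wsq_parallelogram:
  fixes f g :: "'a \<Rightarrow> 'b::real_inner"
  assumes f: "\<And>j. norm (f (x j)) \<le> M" and g: "\<And>j. norm (g (x j)) \<le> M"
  shows "wsq x (\<lambda>z. (1/2) *\<^sub>R (f z - g z)) = (wsq x f + wsq x g) / 2 - wsq x (\<lambda>z. (1/2) *\<^sub>R (f z + g z))"
proof -
  have *: "(norm ((1/2) *\<^sub>R (u - v)))\<^sup>2 = ((norm u)\<^sup>2 + (norm v)\<^sup>2) / 2 - (norm ((1/2) *\<^sub>R (u + v)))\<^sup>2"
    for u v :: 'b
    by (simp add: power2_norm_eq_inner inner_diff inner_add inner_commute algebra_simps)
  have s: "summable (\<lambda>j. (1/2)^j * (norm ((1/2) *\<^sub>R (f (x j) + g (x j))))\<^sup>2 :: real)"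
  proof (rule summable_wsq[where M = M and \<psi> = "\<lambda>z. (1/2) *\<^sub>R (f z + g z)"])
    show "norm ((1 / 2) *\<^sub>R (f (x j) + g (x j))) \<le> M" for j
      using norm_triangle_le[of "f (x j)" "g (x j)" "2 * M"] f[of j] g[of j] by simp
  qed
  note sf = summable_wsq[of f x M, OF f] and sg = summable_wsq[of g x M, OF g]
  have "wsq x (\<lambda>z. (1/2) *\<^sub>R (f z - g z)) = (\<Sum>j. ((1/2)^j * (norm (f (x j)))\<^sup>2 + (1/2)^j * (norm (g (x j)))\<^sup>2) / 2
      - (1/2)^j * (norm ((1/2) *\<^sub>R (f (x j) + g (x j))))\<^sup>2)"
    unfolding wsq_def * by (simp add: algebra_simps add_divide_distrib)
  also have "\<dots> = (wsq x f + wsq x g) / 2 - wsq x (\<lambda>z. (1/2) *\<^sub>R (f z + g z))"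
    unfolding wsq_def
    by (intro sums_unique[symmetric] sums_diff sums_divide sums_add summable_sums sf sg s)
  finally show ?thesis .
qed

lemma dense_sequence:
  fixes D :: "'a::second_countable_topology set"
  assumes "open D" "D \<noteq> {}"
  obtains x :: "nat \<Rightarrow> 'a" where "range x \<subseteq> D" "D \<subseteq> closure (range x)"
proof -
  obtain X :: "'a set" where X: "countable X" "\<And>U. open U \<Longrightarrow> U \<noteq> {} \<Longrightarrow> \<exists>x\<in>X. x \<in> U"
    using countable_dense_setE by blast
  have ne: "X \<inter> D \<noteq> {}" using X(2)[OF assms] by blast
  have "D \<subseteq> closure (X \<inter> D)"
  proof
    fix z assume z: "z \<in> D"
    show "z \<in> closure (X \<inter> D)"
      unfolding closure_iff_nhds_not_empty
    proof (intro allI impI)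
      fix A U assume U: "U \<subseteq> A" "open U" "z \<in> U"
      then have "\<exists>x\<in>X. x \<in> U \<inter> D" using X(2)[of "U \<inter> D"] assms(1) z by blast
      then show "X \<inter> D \<inter> A \<noteq> {}" using U by blast
    qed
  qed
  moreover have "range (from_nat_into (X \<inter> D)) = X \<inter> D"
    using X(1) ne by (intro range_from_nat_into) auto
  ultimately show ?thesis using that[of "from_nat_into (X \<inter> D)"] by simp
qed

section \<open>The invariant minimizer\<close>

text \<open>Composition with a group element \<open>f\<close> only reindexes the supremum, so
  \<open>act f F' \<phi>\<close> is a minimizer along with \<open>\<phi>\<close>. The supremum need
  not be attained; equality of the two is therefore drawn from a sequence of near-maximal group
  elements.\<close>

lemma isotropy_linearization:
  fixes D :: "(complex^'n) set"
  assumes D: "open D" "connected D" "bounded D" "a \<in> D"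
  obtains \<phi> where "holo \<phi> D" "(\<phi> has_derivative (\<lambda>v. v)) (at a)"
    "\<And>g h L L' x. isotropy D a g h L L' \<Longrightarrow> x \<in> D \<Longrightarrow> \<phi> (g x) = L (\<phi> x)"
proof -
  obtain r where r: "0 < r" "ball a r \<subseteq> D"
    using D open_contains_ball by blast
  obtain C where C: "0 < C" "\<And>g h L L' v. isotropy D a g h L L' \<Longrightarrow> norm (L' v) \<le> C * norm v"
    "\<And>g h L L' x y. isotropy D a g h L L' \<Longrightarrow> x \<in> ball a (r/2) \<Longrightarrow> y \<in> ball a (r/2) \<Longrightarrow>
       norm (h x - h y) \<le> C * norm (x - y)"
    using isotropy_bounds[OF D(1,3,4) r] by blast
  obtain R where R: "0 < R" "\<And>x. x \<in> D \<Longrightarrow> norm x \<le> R"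
    using \<open>bounded D\<close> by (auto simp: bounded_pos)
  obtain x :: "nat \<Rightarrow> complex^'n" where x: "range x \<subseteq> D" "D \<subseteq> closure (range x)"
    using dense_sequence[of D] D by blast
  have xD: "x j \<in> D" for j using x(1) by blast
  note lin = isotropy_linear[OF _ D(4)] and inverse = isotropy_inverse[OF _ D(1,4)]
  \<comment> \<open>This bounds the whole orbit of the identity map: \<open>L'\<close> has norm at
    most \<open>C\<close> and \<open>g z\<close> lies in \<open>D\<close>. It makes \<open>K\<close>
    nonempty.\<close>
  define M where "M = C * R"
  \<comment> \<open>As \<open>L'\<close> is the derivative of the inverse of \<open>g\<close>, this
    is the action by \<open>g'(a)^(-1) \<circ> \<psi> \<circ> g\<close>.\<close>
  define act where "act g L' \<psi> = (\<lambda>z. L' (\<psi> (g z)) :: complex^'n)"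
    for g :: "complex^'n \<Rightarrow> complex^'n" and L' \<psi> :: "complex^'n \<Rightarrow> complex^'n"
  \<comment> \<open>The bound is imposed on the entire orbit of \<open>\<psi>\<close>, which makes
    \<open>K\<close> invariant under the action.\<close>
  define K where "K = {\<psi>. holo \<psi> D \<and> (\<psi> has_derivative (\<lambda>v. v)) (at a) \<and>
     (\<forall>g h L L'. isotropy D a g h L L' \<longrightarrow> (\<forall>z\<in>D. norm (act g L' \<psi> z) \<le> M))}"
  define N where "N \<psi> = Sup {wsq x (act g L' \<psi>) |g h L L'. isotropy D a g h L L'}" for \<psi>
  have actM: "norm (act g L' \<psi> z) \<le> M" if "\<psi> \<in> K" "isotropy D a g h L L'" "z \<in> D" for \<psi> g h L L' z
    using that by (auto simp: K_def)
  have KM: "norm (\<psi> z) \<le> M" if "\<psi> \<in> K" "z \<in> D" for \<psi> z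
    using actM[OF that(1) isotropy_id that(2)] by (simp add: act_def)
  have ge: "wsq x (act g L' \<psi>) \<le> N \<psi>" if "\<psi> \<in> K" "isotropy D a g h L L'" for \<psi> g h L L'
    unfolding N_def
  proof (rule cSup_upper)
    show "bdd_above {wsq x (act g L' \<psi>) |g h L L'. isotropy D a g h L L'}"
      using wsq_le[of "act _ _ \<psi>" x M, OF actM[OF that(1) _ xD]] by (intro bdd_aboveI[of _ "2 * M\<^sup>2"]) auto
  qed (use that in blast)
  have Nle: "N \<psi> \<le> B" if "\<And>g h L L'. isotropy D a g h L L' \<Longrightarrow> wsq x (act g L' \<psi>) \<le> B" for \<psi> B
    unfolding N_def using that isotropy_id[of D a] by (intro cSup_least) blast+
  have N0: "0 \<le> N \<psi>" if "\<psi> \<in> K" for \<psi>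
    using ge[OF that isotropy_id] wsq_nonneg[of \<psi> x M, OF KM[OF that xD]] by (simp add: act_def)
  have "(\<lambda>z. z) \<in> K"
  proof -
    have "norm (act g L' (\<lambda>z. z) z) \<le> M" if iso: "isotropy D a g h L L'" and z: "z \<in> D" for g h L L' z
    proof -
      have "norm (L' (g z)) \<le> C * norm (g z)" by (rule C(2)[OF iso])
      also have "\<dots> \<le> C * R" using iso z R(2) C(1) by (intro mult_left_mono) (auto simp: isotropy_def)
      finally show ?thesis by (simp add: act_def M_def)
    qed
    then show ?thesis by (auto simp: K_def holo_ident)
  qed
  define m where "m = Inf (N ` K)"
  have mN: "m \<le> N \<psi>" if "\<psi> \<in> K" for \<psi>
    unfolding m_def using N0 that by (intro cInf_lower bdd_belowI[of _ 0]) auto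

  have "\<exists>\<psi>\<in>K. N \<psi> < m + 1 / Suc k" for k
    using cInf_lessD[of "N ` K" "m + 1 / Suc k"] \<open>(\<lambda>z. z) \<in> K\<close> by (auto simp: m_def)
  then obtain \<psi> where \<psi>: "\<And>k. \<psi> k \<in> K" "\<And>k. N (\<psi> k) < m + 1 / Suc k"
    by metis
  have "holo (\<psi> k) D" for k using \<psi>(1)[of k] by (simp add: K_def)
  then obtain s \<phi> where s: "strict_mono (s :: nat \<Rightarrow> nat)" and \<phi>: "holo \<phi> D"
    "\<And>z. z \<in> D \<Longrightarrow> (\<lambda>k. \<psi> (s k) z) \<longlonglongrightarrow> \<phi> z"
    "\<And>z L. z \<in> D \<Longrightarrow> (\<And>k. (\<psi> k has_derivative L) (at z)) \<Longrightarrow> (\<phi> has_derivative L) (at z)"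
    using holo_montel[of D \<psi> M] D(1) KM[OF \<psi>(1)] by metis
  have lim: "(\<lambda>k. act g L' (\<psi> (s k)) z) \<longlonglongrightarrow> act g L' \<phi> z" if "isotropy D a g h L L'" "z \<in> D" for g h L L' z
    unfolding act_def using that
    by (intro bounded_linear.tendsto[OF lin(1)[OF that(1)]] \<phi>(2)) (auto simp: isotropy_def)
  have "\<phi> \<in> K"
  proof -
    have "(\<psi> k has_derivative (\<lambda>v. v)) (at a)" for k using \<psi>(1)[of k] by (simp add: K_def)
    then have "(\<phi> has_derivative (\<lambda>v. v)) (at a)" using \<phi>(3) D(4) by blast
    moreover have "norm (act g L' \<phi> z) \<le> M" if "isotropy D a g h L L'" "z \<in> D" for g h L L' z
      by (rule Lim_norm_ubound[OF sequentially_bot lim[OF that]])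
        (use actM[OF \<psi>(1) that] in auto)
    ultimately show ?thesis using \<phi>(1) by (auto simp: K_def)
  qed
  \<comment> \<open>Lower semicontinuity: pointwise convergence bounds every finite partial sum by
    \<open>m\<close>, and the bound passes to the series.\<close>
  have Qm: "wsq x (act g L' \<phi>) \<le> m" if iso: "isotropy D a g h L L'" for g h L L'
    unfolding wsq_def
  proof (rule suminf_le_const[OF summable_wsq[of "act g L' \<phi>" x M, OF actM[OF \<open>\<phi> \<in> K\<close> iso xD]]])
    fix J
    have "(\<lambda>k. \<Sum>j<J. (1/2)^j * (norm (act g L' (\<psi> (s k)) (x j)))\<^sup>2 :: real)
        \<longlonglongrightarrow> (\<Sum>j<J. (1/2)^j * (norm (act g L' \<phi> (x j)))\<^sup>2)"
      by (intro tendsto_sum tendsto_mult tendsto_const tendsto_power tendsto_norm lim[OF iso xD])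
    moreover have "(\<lambda>k. m + 1 / Suc (s k)) \<longlonglongrightarrow> m + 0"
      using LIMSEQ_subseq_LIMSEQ[OF lim_1_over_n[THEN LIMSEQ_Suc] s]
      by (intro tendsto_add tendsto_const) (simp add: o_def)
    moreover have "(\<Sum>j<J. (1/2)^j * (norm (act g L' (\<psi> (s k)) (x j)))\<^sup>2) \<le> m + 1 / Suc (s k)" for k
    proof -
      have "(\<Sum>j<J. (1/2)^j * (norm (act g L' (\<psi> (s k)) (x j)))\<^sup>2) \<le> wsq x (act g L' (\<psi> (s k)))"
        unfolding wsq_def
        by (intro sum_le_suminf summable_wsq[of _ x M] actM[OF \<psi>(1) iso xD]) auto
      also have "\<dots> \<le> m + 1 / Suc (s k)"
        using ge[OF \<psi>(1)[of "s k"] iso] \<psi>(2)[of "s k"] by simp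
      finally show ?thesis .
    qed
    ultimately show "(\<Sum>j<J. (1/2)^j * (norm (act g L' \<phi> (x j)))\<^sup>2) \<le> m"
      using LIMSEQ_le by fastforce
  qed

  have "\<phi> (f z) = F (\<phi> z)" if isof: "isotropy D a f f' F F'" and z: "z \<in> D" for f f' F F' z
  proof -
    define \<eta> where "\<eta> = act f F' \<phi>"
    \<comment> \<open>Acting on \<open>\<eta>\<close> by \<open>g\<close> is acting on
      \<open>\<phi>\<close> by \<open>f \<circ> g\<close>, so every bound known for the orbit of
      \<open>\<phi>\<close> holds for that of \<open>\<eta>\<close>.\<close>
    have act_act: "act g L' \<eta> = act (\<lambda>x. f (g x)) (\<lambda>v. L' (F' v)) \<phi>" for g L'
      by (simp add: \<eta>_def act_def)
    have fD: "f w \<in> D" if "w \<in> D" for w using isof that by (simp add: isotropy_def)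
    have hF': "holo F' UNIV" by (rule holo_linear[OF lin(2,3)[OF isof]])
    have "\<eta> \<in> K"
    proof -
      have "holo \<eta> D"
        unfolding \<eta>_def act_def
        using holo_compose[OF holo_compose[of f D \<phi> D] hF'] isof \<phi>(1) fD by (simp add: isotropy_def)
      moreover have "(\<eta> has_derivative (\<lambda>v. v)) (at a)"
      proof -
        have "f a = a" "(f has_derivative F) (at a)" using isof by (auto simp: isotropy_def)
        moreover have "(\<phi> has_derivative (\<lambda>v. v)) (at a)" using \<open>\<phi> \<in> K\<close> by (simp add: K_def)
        ultimately have "((\<lambda>z. \<phi> (f z)) has_derivative F) (at a)"
          using has_derivative_compose[of f F a UNIV \<phi> "\<lambda>v. v"] by simp
        from bounded_linear.has_derivative[OF lin(1)[OF isof] this]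
        show ?thesis by (simp add: \<eta>_def act_def inverse[OF isof])
      qed
      moreover have "norm (act g L' \<eta> z) \<le> M" if "isotropy D a g h L L'" "z \<in> D" for g h L L' z
        unfolding act_act by (rule actM[OF \<open>\<phi> \<in> K\<close> isotropy_comp[OF isof that(1)] that(2)])
      ultimately show ?thesis by (auto simp: K_def)
    qed
    have Qm': "wsq x (act g L' \<eta>) \<le> m" if "isotropy D a g h L L'" for g h L L'
      unfolding act_act by (rule Qm[OF isotropy_comp[OF isof that]])
    \<comment> \<open>The midpoint \<open>\<mu>\<close> of the minimizers \<open>\<phi>\<close> and \<open>\<eta>\<close> has \<open>N \<mu> \<ge> m\<close>; by the parallelogram law,
      \<open>\<delta> \<circ> g\<^sub>k\<close> then becomes small for some \<open>g\<^sub>k\<close> in the group. Since all \<open>g\<^sub>k\<^sup>-\<^sup>1\<close> map a fixed ball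
      around \<open>a\<close> into a compact one, \<open>\<delta>\<close> vanishes near \<open>a\<close>.\<close>
    define \<mu> where "\<mu> = (\<lambda>z. (1/2) *\<^sub>R (\<phi> z + \<eta> z))"
    define \<delta> where "\<delta> = (\<lambda>z. (1/2) *\<^sub>R (\<phi> z - \<eta> z))"
    have act_\<mu>: "act g L' \<mu> = (\<lambda>z. (1/2) *\<^sub>R (act g L' \<phi> z + act g L' \<eta> z))"
      and act_\<delta>: "act g L' \<delta> = (\<lambda>z. (1/2) *\<^sub>R (act g L' \<phi> z - act g L' \<eta> z))"
      if "isotropy D a g h L L'" for g h L L'
      using lin(2)[OF that]
      by (simp_all add: act_def \<mu>_def \<delta>_def fun_eq_iff linear_add linear_diff linear_scale)
    have "holo \<eta> D" using \<open>\<eta> \<in> K\<close> by (simp add: K_def)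
    have "\<mu> \<in> K"
    proof -
      have "holo \<mu> D"
        unfolding \<mu>_def scaleR_eq_smult by (intro holo_smult holo_add \<phi>(1) \<open>holo \<eta> D\<close>)
      moreover have "(\<mu> has_derivative (\<lambda>v. (1/2) *\<^sub>R (v + v))) (at a)"
        unfolding \<mu>_def using \<open>\<phi> \<in> K\<close> \<open>\<eta> \<in> K\<close>
        by (intro has_derivative_scaleR_right has_derivative_add) (auto simp: K_def)
      moreover have "norm (act g L' \<mu> z) \<le> M" if iso: "isotropy D a g h L L'" and z: "z \<in> D" for g h L L' z
        using actM[OF \<open>\<phi> \<in> K\<close> iso z] actM[OF \<open>\<eta> \<in> K\<close> iso z]
          norm_triangle_le[of "act g L' \<phi> z" "act g L' \<eta> z" "2 * M"]
        by (simp add: act_\<mu>[OF iso])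
      moreover have "(\<lambda>v :: complex^'n. (1/2) *\<^sub>R (v + v)) = (\<lambda>v. v)"
        by (simp add: scaleR_2[symmetric])
      ultimately show ?thesis by (auto simp: K_def)
    qed
    have "\<forall>k. \<exists>g h L L'. isotropy D a g h L L' \<and> m - 1 / Suc k < wsq x (act g L' \<mu>)"
    proof (rule allI, rule ccontr)
      fix k assume "\<nexists>g h L L'. isotropy D a g h L L' \<and> m - 1 / Suc k < wsq x (act g L' \<mu>)"
      then have "N \<mu> \<le> m - 1 / Suc k" by (intro Nle) force
      then have "m \<le> m - 1 / Suc k" using mN[OF \<open>\<mu> \<in> K\<close>] by linarith
      moreover have "0 < 1 / real (Suc k)" by simp
      ultimately show False by linarith
    qed
    then obtain g h L L' where iso: "\<And>k. isotropy D a (g k) (h k) (L k) (L' k)"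
      and gt: "\<And>k. m - 1 / Suc k < wsq x (act (g k) (L' k) \<mu>)"
      unfolding choice_iff by blast
    define u where "u k = act (g k) (L' k) \<delta>" for k
    have uM: "norm (u k w) \<le> M" if "w \<in> D" for k w
      using actM[OF \<open>\<phi> \<in> K\<close> iso[of k] that] actM[OF \<open>\<eta> \<in> K\<close> iso[of k] that]
        norm_triangle_le_diff[of "act (g k) (L' k) \<phi> w" "act (g k) (L' k) \<eta> w" "2 * M"]
      by (simp add: u_def act_\<delta>[OF iso])
    have hol\<delta>: "holo \<delta> D"
      unfolding \<delta>_def scaleR_eq_smult by (intro holo_smult holo_diff \<phi>(1) \<open>holo \<eta> D\<close>)
    have holu: "holo (u k) D" for k
    proof -
      have "holo (L' k) UNIV" by (rule holo_linear[OF lin(2,3)[OF iso]])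
      moreover have "holo (g k) D" "\<And>w. w \<in> D \<Longrightarrow> g k w \<in> D" using iso[of k] by (auto simp: isotropy_def)
      ultimately show ?thesis
        unfolding u_def act_def
        using holo_compose[of "g k" D \<delta> D] holo_compose[of "\<lambda>z. \<delta> (g k z)" D "L' k" UNIV] hol\<delta> by simp
    qed
    have u_small: "wsq x (u k) \<le> 1 / Suc k" for k
    proof -
      have "wsq x (u k) = (wsq x (act (g k) (L' k) \<phi>) + wsq x (act (g k) (L' k) \<eta>)) / 2 - wsq x (act (g k) (L' k) \<mu>)"
        unfolding u_def act_\<mu>[OF iso] act_\<delta>[OF iso]
        by (rule wsq_parallelogram[where M = M]; intro actM[OF _ iso xD] \<open>\<phi> \<in> K\<close> \<open>\<eta> \<in> K\<close>)
      moreover have "(wsq x (act (g k) (L' k) \<phi>) + wsq x (act (g k) (L' k) \<eta>)) / 2 \<le> m"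
        using Qm[OF iso[of k]] Qm'[OF iso[of k]] by simp
      ultimately show ?thesis
        using gt[of k] by linarith
    qed
    have u0: "(\<lambda>k. u k (x j)) \<longlonglongrightarrow> 0" for j
    proof -
      \<comment> \<open>For fixed \<open>j\<close> the weight is a constant and can be undone; no
        uniformity in \<open>j\<close> is claimed.\<close>
      have le: "(norm (u k (x j)))\<^sup>2 \<le> 2^j * (1 / Suc k)" for k
      proof -
        have "(norm (u k (x j)))\<^sup>2 = 2^j * ((1/2)^j * (norm (u k (x j)))\<^sup>2)"
          by (simp add: power_one_over)
        also have "\<dots> \<le> 2^j * (1 / Suc k)"
          using order_trans[OF term_le_wsq[of "u k" x M j, OF uM[OF xD]] u_small[of k]]
          by (rule mult_left_mono) simp
        finally show ?thesis .
      qed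
      have "(\<lambda>k. (norm (u k (x j)))\<^sup>2) \<longlonglongrightarrow> 0"
      proof (rule tendsto_sandwich[where f = "\<lambda>_. 0" and h = "\<lambda>k. 2^j * (1 / Suc k)"])
        show "(\<lambda>k. 2^j * (1 / Suc k) :: real) \<longlonglongrightarrow> 0"
          using tendsto_mult_left[OF lim_1_over_n[THEN LIMSEQ_Suc], of "2^j :: real"] by simp
      qed (use le in simp_all)
      then have "(\<lambda>k. sqrt ((norm (u k (x j)))\<^sup>2)) \<longlonglongrightarrow> sqrt 0"
        by (rule tendsto_real_sqrt)
      then show ?thesis
        by (simp add: tendsto_norm_zero_iff)
    qed
    \<comment> \<open>The first bound keeps \<open>w\<close> where the common Lipschitz estimate for
      the \<open>h k\<close> holds; the second forces \<open>h k w\<close> into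
      \<open>cball a (r/4)\<close>.\<close>
    define \<rho> where "\<rho> = min (r/2) (r / (4 * C))"
    have \<rho>: "0 < \<rho>" "\<rho> \<le> r/2" "C * \<rho> \<le> r/4"
    proof -
      have "C * \<rho> \<le> C * (r / (4 * C))" using C(1) by (intro mult_left_mono) (auto simp: \<rho>_def)
      then show "C * \<rho> \<le> r/4" using C(1) by simp
    qed (use r C in \<open>auto simp: \<rho>_def\<close>)
    have "\<delta> w = 0" if w: "w \<in> ball a \<rho>" for w
    proof -
      have wD: "w \<in> D" using w \<rho>(2) r(1) by (intro subsetD[OF r(2)]) simp
      have hk: "h k w \<in> cball a (r/4)" for k
      proof -
        have "h k a = a" using iso[of k] by (simp add: isotropy_def)
        then have "norm (a - h k w) \<le> C * norm (a - w)"
          using C(3)[OF iso[of k], of a w] w \<rho>(2) r(1) by simp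
        also have "\<dots> \<le> C * \<rho>" using w C(1) by (intro mult_left_mono) (auto simp: dist_norm)
        finally show ?thesis using \<rho>(3) by (simp add: dist_norm)
      qed
      have "norm (\<delta> w) \<le> e" if e: "0 < e" for e
      proof -
        have "\<forall>\<^sub>F k in sequentially. \<forall>y\<in>cball a (r/4). norm (u k y) < e / C"
        proof (rule equilipschitz_eventually_small[where X = "ball a (r/2) \<inter> range x"
              and C = "4 * real CARD('n) * M / r"])
          have "cball a (r/4) \<subseteq> ball a (r/2)" using r by auto
          moreover have "ball a (r/2) \<subseteq> D" using r by (intro order_trans[OF _ r(2)]) auto
          ultimately show "cball a (r/4) \<subseteq> closure (ball a (r/2) \<inter> range x)"
            using open_Int_closure_subset[of "ball a (r/2)" "range x"] x(2) by auto
          show "norm (u k y - u k z) \<le> 4 * real CARD('n) * M / r * dist y z"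
            if "y \<in> cball a (r/4)" "z \<in> ball a (r/2) \<inter> range x" for k y z
            unfolding dist_norm
          proof (rule holo_lipschitz[where x = a and f = "u k"])
            show "holo (u k) (ball a r)" using holo_subset[OF holu r(2)] .
            show "norm (u k y) \<le> M" if "y \<in> ball a r" for y using uM r(2) that by blast
          qed (use that r in auto)
          show "0 \<le> 4 * real CARD('n) * M / r" using r C R by (simp add: M_def)
        qed (use u0 e C in auto)
        then obtain k where "\<forall>y\<in>cball a (r/4). norm (u k y) < e / C"
          using eventually_happens'[OF sequentially_bot] by blast
        then have "norm (u k (h k w)) < e / C" using hk by blast
        \<comment> \<open>Since \<open>g k (h k w) = w\<close>, smallness of \<open>u k\<close> on
          the compact ball controls \<open>L' k (\<delta> w)\<close>. Applying \<open>L k\<close>,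
          of norm at most \<open>C\<close>, recovers \<open>\<delta> w\<close>, whence the threshold
          \<open>e / C\<close>.\<close>
        moreover have "u k (h k w) = L' k (\<delta> w)"
          using iso[of k] wD by (simp add: u_def act_def isotropy_def)
        moreover have "norm (L k (L' k (\<delta> w))) \<le> C * norm (L' k (\<delta> w))"
          by (rule C(2)[OF isotropy_sym[OF iso]])
        ultimately show ?thesis
          using inverse[OF isotropy_sym[OF iso[of k]]] C(1) by (simp add: field_simps)
      qed
      then show ?thesis
        using field_le_epsilon[of "norm (\<delta> w)" 0] by simp
    qed
    moreover have "ball a \<rho> \<subseteq> D" using \<rho> r(1) by (intro order_trans[OF _ r(2)]) auto
    ultimately have "\<delta> z = 0"
      using holo_identity[OF D(1,2) hol\<delta> open_ball, of a \<rho>] \<rho>(1) z by auto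
    then have "\<phi> z = F' (\<phi> (f z))" by (simp add: \<delta>_def \<eta>_def act_def)
    then show ?thesis using inverse[OF isotropy_sym[OF isof]] by simp
  qed
  moreover have "(\<phi> has_derivative (\<lambda>v. v)) (at a)" using \<open>\<phi> \<in> K\<close> by (simp add: K_def)
  ultimately show ?thesis using that \<phi>(1) by blast
qed

section \<open>Local biholomorphisms and fixed points\<close>

text \<open>The translate difference \<open>f (z + (x - p)) - f z\<close> has derivative
  \<open>L x - L p\<close> at \<open>p\<close> and is bounded by a multiple of
  \<open>norm (x - p)\<close>; the Cauchy estimate applies to it. This supplies the continuity of
  the derivative required by the inverse function theorem.\<close>

lemma holo_derivative_lipschitz_at:
  fixes f :: "complex^'n \<Rightarrow> complex^'m"
  assumes f: "holo f D" and D: "open D" "p \<in> D"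
    and L: "\<And>z. z \<in> D \<Longrightarrow> (f has_derivative L z) (at z)"
  obtains r K where "0 < r" "ball p r \<subseteq> D"
    "\<And>x v. x \<in> ball p r \<Longrightarrow> norm (L x v - L p v) \<le> K * norm (x - p) * norm v"
proof -
  obtain r where r: "0 < r" "cball p r \<subseteq> D"
    using D open_contains_cball by blast
  have "compact (f ` cball p r)"
    by (rule compact_continuous_image[OF continuous_on_subset[OF holo_imp_continuous_on[OF f] r(2)] compact_cball])
  then obtain M where "\<forall>y\<in>f ` cball p r. norm y \<le> M"
    using compact_imp_bounded bounded_iff by metis
  then have M: "norm (f y) \<le> M" if "y \<in> cball p r" for y
    using that by blast
  have ball: "ball p r \<subseteq> D" using r(2) by auto
  let ?C = "4 * real CARD('m) * M / r"
  show ?thesis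
  proof (rule that[of "r/4" "2 * real CARD('m) * ?C / (r/4)"])
    show "ball p (r/4) \<subseteq> D" using r(1) by (intro order_trans[OF _ r(2)]) auto
    fix x v assume x: "x \<in> ball p (r/4)"
    have shift: "z + (x - p) \<in> ball p (r/2)" "z \<in> ball p (r/2)" if "z \<in> ball p (r/4)" for z
    proof -
      have "dist p (z + (x - p)) \<le> dist p x + dist x (z + (x - p))" by (rule dist_triangle)
      also have "dist x (z + (x - p)) = dist p z" by (simp add: dist_norm)
      finally show "z + (x - p) \<in> ball p (r/2)" using that x by simp
    qed (use that r(1) in simp)
    have half: "ball p (r/2) \<subseteq> ball p r" using r(1) by auto
    let ?w = "\<lambda>z. f (z + (x - p)) - f z"
    have "norm (L x v - L p v) \<le> 2 * real CARD('m) * (?C * norm (x - p)) / (r/4) * norm v"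
    proof (rule holo_derivative_bound[where f = ?w and x = p])
      have "holo (\<lambda>z. f (z + (x - p))) (ball p (r/4))"
      proof (rule holo_compose[where V = D])
        show "holo (\<lambda>z. z + (x - p)) (ball p (r/4))"
          by (intro holo_add holo_ident holo_const)
        show "z + (x - p) \<in> D" if "z \<in> ball p (r/4)" for z
          using shift(1)[OF that] half ball by blast
      qed (rule f)
      moreover have "holo f (ball p (r/4))"
        using shift(2) half ball by (intro holo_subset[OF f]) blast
      ultimately show "holo ?w (ball p (r/4))" by (rule holo_diff)
      have "((\<lambda>z. f (z + (x - p))) has_derivative (\<lambda>v. L x v)) (at p)"
      proof -
        have "((\<lambda>z. z + (x - p)) has_derivative (\<lambda>v. v)) (at p)"
          by (rule has_derivative_add_const[OF has_derivative_ident])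
        moreover have "x \<in> D" using x r(1) by (intro subsetD[OF ball]) simp
        then have "(f has_derivative L x) (at (p + (x - p)))" using L by simp
        ultimately show ?thesis by (rule has_derivative_compose)
      qed
      then show "(?w has_derivative (\<lambda>v. L x v - L p v)) (at p)"
        by (rule has_derivative_diff) (rule L[OF D(2)])
      show "norm (?w z) \<le> ?C * norm (x - p)" if "z \<in> ball p (r/4)" for z
      proof -
        have "norm (f (z + (x - p)) - f z) \<le> ?C * norm (z + (x - p) - z)"
          by (rule holo_lipschitz[OF holo_subset[OF f ball] r(1) M shift[OF that]]) simp
        then show ?thesis by simp
      qed
    qed (use r(1) in simp)
    then show "norm (L x v - L p v) \<le> 2 * real CARD('m) * ?C / (r/4) * norm (x - p) * norm v"
      by (simp add: mult.assoc)
  qed (use r(1) in simp)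
qed

text \<open>The real inverse function theorem gives a differentiable inverse, whose derivative
  inverts a complex-linear map and so is complex-linear. All open \<open>W\<close> inside
  \<open>U\<close> are covered because the neighbourhood is shrunk later;
  \<open>inv_into W f\<close> depends on \<open>W\<close> but agrees with \<open>g\<close> on the
  image of \<open>W\<close>.\<close>

lemma holo_local_biholomorphism:
  fixes f :: "complex^'n \<Rightarrow> complex^'n"
  assumes f: "holo f D" and D: "open D" "a \<in> D"
    and T: "(f has_derivative T) (at a)" "linear T'" "\<And>v. T' (T v) = v"
  obtains U where "open U" "a \<in> U" "U \<subseteq> D" "inj_on f U"
    "\<And>W. open W \<Longrightarrow> W \<subseteq> U \<Longrightarrow> open (f ` W) \<and> biholomorphic f W (f ` W)"
proof -
  have "\<forall>z\<in>D. \<exists>L. (f has_derivative L) (at z)"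
    using f by (auto simp: holo_def)
  then obtain L where L: "\<And>z. z \<in> D \<Longrightarrow> (f has_derivative L z) (at z)"
    by metis
  have bl: "blinfun_apply (Blinfun (L z)) = L z" if "z \<in> D" for z
    using has_derivative_bounded_linear[OF L[OF that]] by (rule bounded_linear_Blinfun_apply)
  have cont: "continuous_on D (\<lambda>z. Blinfun (L z))"
    unfolding continuous_on_eq_continuous_at[OF D(1)]
  proof
    fix p assume p: "p \<in> D"
    obtain r K where rK: "0 < r" "ball p r \<subseteq> D"
      "\<And>x v. x \<in> ball p r \<Longrightarrow> norm (L x v - L p v) \<le> K * norm (x - p) * norm v"
      using holo_derivative_lipschitz_at[OF f D(1) p L] by metis
    have "norm (Blinfun (L x) - Blinfun (L p)) \<le> \<bar>K\<bar> * norm (x - p)" if x: "x \<in> ball p r" for x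
    proof (rule norm_blinfun_bound)
      show "norm ((Blinfun (L x) - Blinfun (L p)) v) \<le> \<bar>K\<bar> * norm (x - p) * norm v" for v
      proof -
        have "norm (L x v - L p v) \<le> K * norm (x - p) * norm v" by (rule rK(3)[OF x])
        also have "\<dots> \<le> \<bar>K\<bar> * norm (x - p) * norm v" by (intro mult_right_mono) auto
        finally show ?thesis
          using bl[OF p] bl[of x] x rK(2) by (auto simp: blinfun.diff_left)
      qed
    qed simp
    then have "\<forall>\<^sub>F x in at p. norm (Blinfun (L x) - Blinfun (L p)) \<le> \<bar>K\<bar> * norm (x - p)"
      using eventually_at_in_open'[of "ball p r" p] rK(1)
      by (auto elim!: eventually_mono)
    moreover have "((\<lambda>x. \<bar>K\<bar> * norm (x - p)) \<longlongrightarrow> \<bar>K\<bar> * norm (p - p)) (at p)"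
      by (intro tendsto_intros)
    ultimately have "((\<lambda>x. Blinfun (L x) - Blinfun (L p)) \<longlongrightarrow> 0) (at p)"
      using Lim_null_comparison by fastforce
    then show "isCont (\<lambda>z. Blinfun (L z)) p"
      unfolding isCont_def by (rule LIM_zero_cancel)
  qed
  have LT: "L a = T" using has_derivative_unique[OF L[OF D(2)] T(1)] .
  have "bounded_linear T'" using T(2) by (simp add: linear_conv_bounded_linear)
  then have invT: "Blinfun T' o\<^sub>L Blinfun (L a) = id_blinfun"
    by (intro blinfun_eqI) (simp add: bl[OF D(2), unfolded LT] LT bounded_linear_Blinfun_apply T(3))
  have der: "(f has_derivative blinfun_apply (Blinfun (L z))) (at z)" if "z \<in> D" for z
    using L[OF that] bl[OF that] by simp
  obtain U V g g' where U: "open U" "U \<subseteq> D" "a \<in> U" and V: "open V" "f a \<in> V"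
    and hom: "homeomorphism U V f g"
    and g: "\<And>y. y \<in> V \<Longrightarrow> (g has_derivative (g' y)) (at y)"
      "\<And>y. y \<in> V \<Longrightarrow> g' y = inv (blinfun_apply (Blinfun (L (g y))))"
      "\<And>y. y \<in> V \<Longrightarrow> bij (blinfun_apply (Blinfun (L (g y))))"
    using inverse_function_theorem[OF D(1) der cont D(2) invT] by metis
  have gf: "g (f x) = x" if "x \<in> U" for x using hom that by (simp add: homeomorphism_def)
  have "holo g V"
    unfolding holo_def
  proof (intro ballI exI conjI allI)
    fix y assume y: "y \<in> V"
    show "(g has_derivative g' y) (at y)" by (rule g(1)[OF y])
    have gy: "g y \<in> D" using hom y U(2) by (auto simp: homeomorphism_def)
    have inv: "g' y = inv (L (g y))" "bij (L (g y))" using g(2,3)[OF y] bl[OF gy] by simp_all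
    fix c v
    have "L (g y) (c *s g' y v) = c *s v"
      using holo_has_derivative_linear[OF f gy L[OF gy]] inv by (simp add: bij_is_surj surj_f_inv_f)
    then show "g' y (c *s v) = c *s g' y v"
      using inv by (metis bij_is_inj inv_f_f)
  qed
  show ?thesis
  proof (rule that[OF U(1,3,2)])
    show inj: "inj_on f U" using gf by (metis inj_onI)
    fix W assume W: "open W" "W \<subseteq> U"
    have "f ` W = V \<inter> g -` W"
      using hom W by (force simp: homeomorphism_def image_iff)
    then have op: "open (f ` W)"
      using continuous_open_preimage[OF holo_imp_continuous_on[OF \<open>holo g V\<close>] V(1) W(1)] by simp
    have inj': "inj_on f W" using inj W(2) inj_on_subset by blast
    have "holo (inv_into W f) (f ` W)"
      unfolding holo_def
    proof
      fix y assume y: "y \<in> f ` W"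
      then have "y \<in> V" using hom W(2) by (auto simp: homeomorphism_def)
      then obtain M where M: "(g has_derivative M) (at y)" "\<forall>c v. M (c *s v) = c *s M v"
        using \<open>holo g V\<close> by (auto simp: holo_def)
      have "(inv_into W f has_derivative M) (at y)"
      proof (rule has_derivative_transform_within_open[OF M(1) op y])
        show "g z = inv_into W f z" if "z \<in> f ` W" for z
          using that inv_into_f_f[OF inj'] gf W(2) by auto
      qed
      then show "\<exists>M. (inv_into W f has_derivative M) (at y) \<and> (\<forall>c v. M (c *s v) = c *s M v)"
        using M(2) by blast
    qed
    moreover have "holo f W" using holo_subset[OF f] W(2) U(2) by blast
    ultimately show "open (f ` W) \<and> biholomorphic f W (f ` W)"
      using op inj' by (simp add: biholomorphic_def holo_map_on_iff_holo bij_betw_def)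
  qed
qed

section \<open>Straightening a complex subspace\<close>

lemma span_axis_image:
  "vec.span ((\<lambda>i. axis i 1) ` I) = {w :: complex^'n. \<forall>i. i \<notin> I \<longrightarrow> w $ i = 0}"
proof (intro equalityI subsetI)
  fix w :: "complex^'n" assume "w \<in> vec.span ((\<lambda>i. axis i 1) ` I)"
  moreover have "vec.subspace {w :: complex^'n. \<forall>i. i \<notin> I \<longrightarrow> w $ i = 0}"
    by (simp add: vec.subspace_def)
  moreover have "(\<lambda>i. axis i 1) ` I \<subseteq> {w :: complex^'n. \<forall>i. i \<notin> I \<longrightarrow> w $ i = 0}"
    by (auto simp: axis_def)
  ultimately show "w \<in> {w. \<forall>i. i \<notin> I \<longrightarrow> w $ i = 0}"
    using vec.span_minimal by blast
next
  fix w :: "complex^'n" assume w: "w \<in> {w. \<forall>i. i \<notin> I \<longrightarrow> w $ i = 0}"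
  have "(\<Sum>i\<in>UNIV. (w $ i) *s axis i 1) \<in> vec.span ((\<lambda>i. axis i 1) ` I)"
  proof (rule vec.span_sum)
    show "(w $ i) *s axis i 1 \<in> vec.span ((\<lambda>i. axis i 1) ` I)" for i
      using w by (cases "i \<in> I") (auto intro: vec.span_scale vec.span_base vec.span_zero)
  qed
  then show "w \<in> vec.span ((\<lambda>i. axis i 1) ` I)"
    by (simp add: basis_expansion)
qed

text \<open>A basis of \<open>E\<close> is sent injectively to coordinate axes and the assignment is
  extended to an injective complex-linear map. The nonzero vector makes the basis, and hence
  \<open>I\<close>, nonempty.\<close>

lemma subspace_straighten:
  fixes E :: "(complex^'n) set"
  assumes E: "vec.subspace E" and v: "v \<in> E" "v \<noteq> 0"
  obtains P P' :: "complex^'n \<Rightarrow> complex^'n" and I where "linear P" "\<And>c v. P (c *s v) = c *s P v"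
    "linear P'" "\<And>v. P' (P v) = v" "card I \<ge> 1" "\<And>v. v \<in> E \<longleftrightarrow> (\<forall>i. i \<notin> I \<longrightarrow> P v $ i = 0)"
proof -
  obtain B where B: "B \<subseteq> E" "vec.independent B" "E \<subseteq> vec.span B" "card B = vec.dim E"
    using vec.basis_exists by blast
  have fin: "finite B" using B(2) by (rule vec.finiteI_independent)
  have span: "vec.span B = E"
    using B E by (meson antisym vec.span_minimal)
  have "B \<noteq> {}" using B(3) v by auto
  have "card B \<le> card (UNIV :: 'n set)"
    using B(4) vec.dim_subset_UNIV[of E] by (simp add: vec.dimension_def card_cart_basis)
  then obtain I :: "'n set" where I: "card I = card B"
    by (meson obtain_subset_with_card_n)
  obtain f where f: "bij_betw f B I"
    using finite_same_card_bij[OF fin finite I[symmetric]] by blast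
  let ?f = "\<lambda>b. axis (f b) 1 :: complex^'n"
  have im: "?f ` B = (\<lambda>i. axis i 1) ` I"
    using f by (auto simp: bij_betw_def)
  have "vec.independent (?f ` B)"
    by (rule vec.independent_mono[OF independent_cart_basis]) (auto simp: cart_basis_def)
  moreover have "inj_on ?f B"
    using f by (auto simp: inj_on_def bij_betw_def axis_eq_axis)
  ultimately obtain P where P: "Vector_Spaces.linear (*s) (*s) P" "inj P" "\<forall>x\<in>B. P x = ?f x"
    using vec.linear_independent_extend_inj[OF B(2)] by blast
  interpret P: Vector_Spaces.linear "(*s)" "(*s)" P by (rule P(1))
  have "P ` B = ?f ` B" using P(3) by auto
  then have PE: "P ` E = {w. \<forall>i. i \<notin> I \<longrightarrow> w $ i = 0}"
    using P.span_image[of B] span im span_axis_image[of I] by simp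
  have lin: "linear P"
    by (rule linearI) (simp_all add: P.add P.scale scaleR_eq_smult)
  obtain P' where P': "linear P'" "P' \<circ> P = id"
    using linear_injective_left_inverse[OF lin P(2)] by blast
  show ?thesis
  proof (rule that[OF lin P.scale P'(1)])
    show "P' (P v) = v" for v using P'(2) by (metis comp_apply id_apply)
    show "1 \<le> card I" using I fin \<open>B \<noteq> {}\<close> by (simp add: Suc_le_eq card_gt_0_iff)
    show "v \<in> E \<longleftrightarrow> (\<forall>i. i \<notin> I \<longrightarrow> P v $ i = 0)" for v
      using inj_image_mem_iff[OF P(2), of v E] unfolding PE by simp
  qed
qed

section \<open>Dimension bounds and the fixed point theorem\<close>

lemma regular_point_le: "regular_point (A :: (complex^'n) set) p d \<Longrightarrow> d \<le> CARD('n)"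
  unfolding regular_point_def by (auto intro: card_mono)

text \<open>Finiteness gives \<open>Max\<close> in \<open>analytic_dim\<close> its usual
  meaning.\<close>

lemma finite_regular_dims: "finite {int d | d p. regular_point (A :: (complex^'n) set) p d}"
  by (rule finite_subset[of _ "int ` {..CARD('n)}"]) (auto dest: regular_point_le)

theorem lemma3p2:
  fixes D :: "(complex^'n) set" and a :: "complex^'n"
  assumes "domain_Cn D" and "bounded D" and "a \<in> D"
  shows "\<exists>Z. analytic_subset D Z \<and> analytic_dim Z < int CARD('n) \<and>
           (\<forall>b \<in> D - Z. \<forall>f. holo_automorphism D f \<and> f a = a \<and> f b = b \<longrightarrow>
              analytic_dim {x \<in> D. f x = x} \<ge> 1)"
proof -
  have D: "open D" "connected D" using assms(1) by (auto simp: domain_Cn_def)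
  obtain \<phi> where \<phi>: "holo \<phi> D" "(\<phi> has_derivative (\<lambda>v. v)) (at a)"
    "\<And>g h L L' x. isotropy D a g h L L' \<Longrightarrow> x \<in> D \<Longrightarrow> \<phi> (g x) = L (\<phi> x)"
    using isotropy_linearization[OF D assms(2,3)] by blast
  let ?Z = "{z\<in>D. \<phi> z = 0}"
  have "analytic_subset D ?Z"
    unfolding analytic_subset_def
  proof (intro conjI ballI exI)
    show "finite (range (\<lambda>i z. \<phi> z $ i))" by simp
    show "holo_fun_on g D" if "g \<in> range (\<lambda>i z. \<phi> z $ i)" for g
      using that \<phi>(1) unfolding holo_map_on_iff_holo[symmetric] holo_map_on_def by auto
    show "?Z \<inter> D = {z\<in>D. \<forall>g\<in>range (\<lambda>i z. \<phi> z $ i). g z = 0}" by (auto simp: vec_eq_iff)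
  qed (use D in auto)
  moreover have "analytic_dim ?Z < int CARD('n)"
  proof -
    \<comment> \<open>At a regular point of full dimension the zero set contains an open set. Then
      \<open>\<phi>\<close> vanishes on \<open>D\<close>, against its derivative at
      \<open>a\<close>.\<close>
    have "d \<noteq> CARD('n)" if "regular_point ?Z p d" for p d
    proof
      assume d: "d = CARD('n)"
      obtain U V I and \<psi> :: "complex^'n \<Rightarrow> complex^'n" where U: "open U" "p \<in> U" "biholomorphic \<psi> U V" "card I = d"
        "\<psi> ` (?Z \<inter> U) = {w\<in>V. \<forall>i. i \<notin> I \<longrightarrow> w $ i = 0}"
        using \<open>regular_point ?Z p d\<close> unfolding regular_point_def by blast
      have "I = UNIV" using U(4) d by (intro card_subset_eq) auto
      then have "\<psi> ` (?Z \<inter> U) = \<psi> ` U" and inj: "inj_on \<psi> U"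
        using U(3,5) by (auto simp: biholomorphic_def bij_betw_def)
      then have "?Z \<inter> U = U"
        using inj_on_image_eq_iff[OF inj, of "?Z \<inter> U" U] by blast
      then have "U \<subseteq> ?Z" by blast
      then have zero: "\<phi> z = 0" if "z \<in> D" for z
        using holo_identity[OF D \<phi>(1) U(1), of z] U(2) that by blast
      have "(\<phi> has_derivative (\<lambda>v. 0)) (at a)"
        by (rule has_derivative_transform_within_open[OF has_derivative_const D(1) assms(3)])
          (simp add: zero)
      then have "(\<lambda>v :: complex^'n. v) = (\<lambda>v. 0)"
        using \<phi>(2) has_derivative_unique by blast
      from fun_cong[OF this, of 1] show False by simp
    qed
    then have "int d < int CARD('n)" if "regular_point ?Z p d" for p d
      using regular_point_le[OF that] that by force
    then show ?thesis
      unfolding analytic_dim_def using finite_regular_dims[of ?Z] by (subst Max_less_iff) auto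
  qed
  moreover have "analytic_dim {x \<in> D. f x = x} \<ge> 1"
    if b: "b \<in> D - ?Z" and f: "holo_automorphism D f" "f a = a" "f b = b" for b f
  proof -
    let ?A = "{x \<in> D. f x = x}"
    have bij: "bij_betw f D D" and hol: "holo f D" "holo (inv_into D f) D"
      using f(1) by (auto simp: holo_automorphism_def biholomorphic_def holo_map_on_iff_holo)
    obtain L L' where L: "(f has_derivative L) (at a)" "(inv_into D f has_derivative L') (at a)"
      using hol assms(3) unfolding holo_def by blast
    have iso: "isotropy D a f (inv_into D f) L L'"
      unfolding isotropy_def using hol L f(2) assms(3) bij
      by (auto simp: bij_betw_def inv_into_into f_inv_into_f intro: inv_into_f_eq)
    \<comment> \<open>The eigenspace of the derivative for the eigenvalue 1; it contains
      \<open>\<phi> b\<close> because \<open>\<phi> b = \<phi> (f b) = L (\<phi> b)\<close>.\<close>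
    define E where "E = {v. L v = v}"
    have L0: "linear L" "\<And>c v. L (c *s v) = c *s L v"
      using isotropy_linear[OF isotropy_sym[OF iso] assms(3)] by blast+
    have "vec.subspace E"
      by (simp add: vec.subspace_def E_def linear_add[OF L0(1)] linear_0[OF L0(1)] L0(2))
    moreover have "\<phi> b \<in> E" "\<phi> b \<noteq> 0"
      using \<phi>(3)[OF iso, of b] b f(3) by (auto simp: E_def)
    ultimately obtain P P' :: "complex^'n \<Rightarrow> complex^'n" and I where P: "linear P" "\<And>c v. P (c *s v) = c *s P v"
      "linear P'" "\<And>v. P' (P v) = v" "card I \<ge> 1" "\<And>v. v \<in> E \<longleftrightarrow> (\<forall>i. i \<notin> I \<longrightarrow> P v $ i = 0)"
      using subspace_straighten by metis
    \<comment> \<open>A chart at \<open>a\<close> in which \<open>E\<close> becomes a coordinate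
      subspace; its derivative there is the invertible map \<open>P\<close>.\<close>
    define \<Phi> where "\<Phi> = (\<lambda>x. P (\<phi> x))"
    have "holo \<Phi> D"
      unfolding \<Phi>_def by (rule holo_compose[OF \<phi>(1) holo_linear[OF P(1,2), of UNIV]]) simp
    moreover have "(\<Phi> has_derivative P) (at a)"
      unfolding \<Phi>_def using bounded_linear.has_derivative[OF _ \<phi>(2), of P] P(1)
      by (simp add: linear_conv_bounded_linear)
    ultimately obtain U where U: "open U" "a \<in> U" "U \<subseteq> D" "inj_on \<Phi> U"
      "\<And>W. open W \<Longrightarrow> W \<subseteq> U \<Longrightarrow> open (\<Phi> ` W) \<and> biholomorphic \<Phi> W (\<Phi> ` W)"
      using holo_local_biholomorphism[OF _ D(1) assms(3) _ P(3,4)] by blast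
    \<comment> \<open>Both \<open>x\<close> and \<open>f x\<close> must lie in \<open>U\<close>, so
      that injectivity of \<open>\<Phi>\<close> turns \<open>\<Phi> (f x) = \<Phi> x\<close> into
      \<open>f x = x\<close>.\<close>
    define W where "W = U \<inter> f -` U"
    have W: "open W" "a \<in> W" "W \<subseteq> U"
      using continuous_open_preimage[OF continuous_on_subset[OF holo_imp_continuous_on[OF hol(1)] U(3)] U(1,1)] U(2) f(2)
      by (auto simp: W_def)
    have fix_iff: "f x = x \<longleftrightarrow> (\<forall>i. i \<notin> I \<longrightarrow> \<Phi> x $ i = 0)" if x: "x \<in> W" for x
    proof -
      have "f x = x \<longleftrightarrow> \<Phi> (f x) = \<Phi> x"
        using inj_onD[OF U(4), of "f x" x] x by (auto simp: W_def)
      also have "\<dots> \<longleftrightarrow> \<phi> (f x) = \<phi> x"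
        unfolding \<Phi>_def using P(4) by metis
      also have "\<dots> \<longleftrightarrow> \<phi> x \<in> E"
        using \<phi>(3)[OF iso, of x] x W(3) U(3) by (auto simp: E_def)
      finally show ?thesis by (simp add: P(6) \<Phi>_def)
    qed
    have "regular_point ?A a (card I)"
      unfolding regular_point_def
    proof (intro conjI exI)
      show "a \<in> ?A" using assms(3) f(2) by simp
      show "open W" "a \<in> W" by (fact W)+
      show "open (\<Phi> ` W)" "biholomorphic \<Phi> W (\<Phi> ` W)" using U(5)[OF W(1,3)] by auto
      show "\<Phi> ` (?A \<inter> W) = {w \<in> \<Phi> ` W. \<forall>i. i \<notin> I \<longrightarrow> w $ i = 0}"
        using fix_iff W(3) U(3) by auto
    qed simp
    then have "int (card I) \<le> analytic_dim ?A"
      unfolding analytic_dim_def using finite_regular_dims[of ?A] by (intro Max_ge) auto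
    then show ?thesis using P(5) by simp
  qed
  ultimately show ?thesis by (intro exI[of _ ?Z]) blast
qed

end
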